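(* Let $\mathcal B$ be a separable complex Banach space, $p\in\mathbb N$, $\Phi_1,\dots,\Phi_p\in\mathcal L(\mathcal B)$, $\Phi(z)=I-\sum_{j=1}^p\Phi_jz^j$, and suppose that $\Phi$ satisfies the unit root assumption. Let $\widetilde\Phi(z)=I_p-z\widetilde\Phi_1$ be the companion pencil of $\Phi$ on $\mathcal B^p$, let $\widetilde\Phi(z)^{-1}=-\sum_{j=-d}^\infty\widetilde{\mathrm N}_j(z-1)^j$ ($d\in\mathbb N\cup\{\infty\}$) be its Laurent series near $z=1$, and put $\widetilde{\mathrm P}=\widetilde{\mathrm N}_{-1}\widetilde\Phi_1$. The following conditions are equivalent. (i) $\widetilde\Phi(z)^{-1}$ has a simple pole at $z=1$. (ii) $\widetilde{\mathrm P}$ is the projection onto $\ker\widetilde\Phi(1)$ along $\operatorname{ran}\widetilde\Phi(1)$. (iii) $\mathcal B^p=\operatorname{ran}\widetilde\Phi(1)\oplus\ker\widetilde\Phi(1)$. Under any of these conditions, for some $\eta>0$, $$(1-z)\widetilde\Phi(z)^{-1}=\widetilde{\mathrm P}+(1-z)H(z),\qquad z\in D_{1+\eta}$$ (the left side being extended holomorphically to $z=1$), where $H(z)$ denotes the holomorphic part of the Laurent series of $\widetilde\Phi(z)^{-1}$ around $z=1$. Moreover, the Maclaurin series of $(1-z)\widetilde\Phi(z)^{-1}$ and of $H(z)$ are each convergent on $D_{1+\eta}$.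
   Context: $\mathcal L(\mathcal B)$ is the space of bounded linear operators on $\mathcal B$. For an operator-valued function $A$ on $\mathbb C$, $\sigma(A)=\{z\in\mathbb C: A(z)\text{ is not invertible}\}$. $D_R$ is the open disk in $\mathbb C$ of radius $R$ centered at $0$. Direct sums $\oplus$ are between closed subspaces (complements are closed). Unit root assumption: (a) $\sigma(\Phi)\cap D_{1+\eta}=\{1\}$ for some $\eta>0$, and $\Phi(1)\ne0$; (b) $\mathcal B=\operatorname{ran}\Phi(1)\oplus[\operatorname{ran}\Phi(1)]_\complement=\ker\Phi(1)\oplus[\ker\Phi(1)]_\complement$ for some subspaces $[\operatorname{ran}\Phi(1)]_\complement$, $[\ker\Phi(1)]_\complement$ of $\mathcal B$. $\mathcal B^p$ carries the norm $\|(x_1,\dots,x_p)\|=\sum_j\|x_j\|$, $I_p$ is its identity operator, and $\widetilde\Phi_1\in\mathcal L(\mathcal B^p)$ is $\widetilde\Phi_1(x_1,\dots,x_p)=(\sum_{j=1}^p\Phi_jx_j,\,x_1,\dots,x_{p-1})$. One has $\sigma(\widetilde\Phi)=\sigma(\Phi)$, so $1$ is an isolated point of $\sigma(\widetilde\Phi)$. The holomorphic part of the Laurent series is $H(z)=-\sum_{j=0}^\infty\widetilde{\mathrm N}_j(z-1)^j$ (and its holomorphic continuation). *)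

theory Defs
  imports "HOL-Analysis.Analysis"
begin

section \<open>Complex normed spaces\<close>

class complex_normed_vector = real_normed_vector +
  fixes scaleC :: "complex \<Rightarrow> 'a \<Rightarrow> 'a"  (infixr \<open>*\<^sub>C\<close> 75)
  assumes scaleC_add_right: "c *\<^sub>C (x + y) = c *\<^sub>C x + c *\<^sub>C y"
    and scaleC_add_left: "(c + d) *\<^sub>C x = c *\<^sub>C x + d *\<^sub>C x"
    and scaleC_scaleC: "c *\<^sub>C d *\<^sub>C x = (c * d) *\<^sub>C x"
    and scaleC_of_real: "complex_of_real r *\<^sub>C x = r *\<^sub>R x"
    and norm_scaleC: "norm (c *\<^sub>C x) = cmod c * norm x"

class complex_banach = complex_normed_vector + banach

lemma bounded_linear_scaleC:
  "bounded_linear (\<lambda>x::'a::complex_normed_vector. c *\<^sub>C x)"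
proof (rule bounded_linear_intro[where K = "cmod c"])
  fix r :: real and x :: 'a
  show "c *\<^sub>C (r *\<^sub>R x) = r *\<^sub>R (c *\<^sub>C x)"
    by (simp add: scaleC_of_real[symmetric] scaleC_scaleC mult.commute)
qed (simp_all add: scaleC_add_right norm_scaleC mult.commute)

instantiation blinfun :: (real_normed_vector, complex_normed_vector) complex_normed_vector
begin

lift_definition scaleC_blinfun :: "complex \<Rightarrow> ('a \<Rightarrow>\<^sub>L 'b) \<Rightarrow> ('a \<Rightarrow>\<^sub>L 'b)"
  is "\<lambda>c A x. c *\<^sub>C A x"
  using bounded_linear_compose[OF bounded_linear_scaleC] .

instance
proof
  fix c d :: complex and r :: real and A B :: "'a \<Rightarrow>\<^sub>L 'b"
  show "c *\<^sub>C (A + B) = c *\<^sub>C A + c *\<^sub>C B"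
    by transfer (simp add: scaleC_add_right)
  show "(c + d) *\<^sub>C A = c *\<^sub>C A + d *\<^sub>C A"
    by transfer (simp add: scaleC_add_left)
  show "c *\<^sub>C d *\<^sub>C A = (c * d) *\<^sub>C A"
    by transfer (simp add: scaleC_scaleC)
  show "complex_of_real r *\<^sub>C A = r *\<^sub>R A"
    by transfer (simp add: scaleC_of_real)
  have le: "norm (c *\<^sub>C A) \<le> cmod c * norm A" for c and A :: "'a \<Rightarrow>\<^sub>L 'b"
    by (rule norm_blinfun_bound)
      (auto simp: scaleC_blinfun.rep_eq norm_scaleC mult.assoc intro!: mult_left_mono norm_blinfun)
  show "norm (c *\<^sub>C A) = cmod c * norm A"
  proof (cases "c = 0")
    case True
    then show ?thesis using le[of c A] by simp
  next
    case False
    have "inverse c *\<^sub>C c *\<^sub>C A = A"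
    proof (rule blinfun_eqI)
      fix x
      have "inverse c *\<^sub>C c *\<^sub>C blinfun_apply A x = complex_of_real 1 *\<^sub>C blinfun_apply A x"
        using False by (simp add: scaleC_scaleC)
      then show "blinfun_apply (inverse c *\<^sub>C c *\<^sub>C A) x = blinfun_apply A x"
        by (simp only: scaleC_blinfun.rep_eq scaleC_of_real scaleR_one)
    qed
    then have "norm A \<le> inverse (cmod c) * norm (c *\<^sub>C A)"
      using le[of "inverse c" "c *\<^sub>C A"] by (simp add: norm_inverse)
    then have "cmod c * norm A \<le> norm (c *\<^sub>C A)"
      using False by (simp add: field_simps)
    then show ?thesis using le[of c A] by simp
  qed
qed

end

section \<open>Bounded complex-linear operators\<close>

text \<open>
  The type \<open>'a \<Rightarrow>\<^sub>L 'b\<close> consists of the bounded \<^emph>\<open>real\<close>-linear maps. The space of bounded operators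
  of a complex space is its subspace cut out by \<open>clinear_op\<close>; the two operator norms agree there.
\<close>

definition clinear_op :: "('a::complex_normed_vector \<Rightarrow>\<^sub>L 'b::complex_normed_vector) \<Rightarrow> bool" where
  "clinear_op A \<longleftrightarrow> (\<forall>c x. blinfun_apply A (c *\<^sub>C x) = c *\<^sub>C blinfun_apply A x)"

definition inverse_op :: "('a::complex_normed_vector \<Rightarrow>\<^sub>L 'a) \<Rightarrow> ('a \<Rightarrow>\<^sub>L 'a) \<Rightarrow> bool" where
  "inverse_op A B \<longleftrightarrow> clinear_op B \<and> A o\<^sub>L B = id_blinfun \<and> B o\<^sub>L A = id_blinfun"

definition invertible_op :: "('a::complex_normed_vector \<Rightarrow>\<^sub>L 'a) \<Rightarrow> bool" where
  "invertible_op A \<longleftrightarrow> (\<exists>B. inverse_op A B)"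

text \<open>Unspecified when the operator is not invertible.\<close>

definition op_inv :: "('a::complex_normed_vector \<Rightarrow>\<^sub>L 'a) \<Rightarrow> ('a \<Rightarrow>\<^sub>L 'a)" where
  "op_inv A = (THE B. inverse_op A B)"

definition spectrum_of :: "(complex \<Rightarrow> ('a::complex_normed_vector \<Rightarrow>\<^sub>L 'a)) \<Rightarrow> complex set" where
  "spectrum_of A = {z. \<not> invertible_op (A z)}"

definition ran_op :: "('a::real_normed_vector \<Rightarrow>\<^sub>L 'b::real_normed_vector) \<Rightarrow> 'b set" where
  "ran_op A = range (blinfun_apply A)"

definition ker_op :: "('a::real_normed_vector \<Rightarrow>\<^sub>L 'b::real_normed_vector) \<Rightarrow> 'a set" where
  "ker_op A = {x. blinfun_apply A x = 0}"

definition closed_csubspace :: "'a::complex_normed_vector set \<Rightarrow> bool" where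
  "closed_csubspace U \<longleftrightarrow> closed U \<and> 0 \<in> U \<and> (\<forall>x\<in>U. \<forall>y\<in>U. x + y \<in> U) \<and> (\<forall>c. \<forall>x\<in>U. c *\<^sub>C x \<in> U)"

definition space_is_direct_sum :: "'a::complex_normed_vector set \<Rightarrow> 'a set \<Rightarrow> bool" where
  "space_is_direct_sum U V \<longleftrightarrow>
     closed_csubspace U \<and> closed_csubspace V \<and> U \<inter> V = {0} \<and> (\<forall>x. \<exists>u\<in>U. \<exists>v\<in>V. x = u + v)"

definition projection_onto_along :: "('a::complex_normed_vector \<Rightarrow>\<^sub>L 'a) \<Rightarrow> 'a set \<Rightarrow> 'a set \<Rightarrow> bool" where
  "projection_onto_along P U V \<longleftrightarrow>
     clinear_op P \<and> P o\<^sub>L P = P \<and> ran_op P = U \<and> ker_op P = V"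

section \<open>Vector-valued functions of a complex variable\<close>

definition has_cderiv :: "(complex \<Rightarrow> 'a::complex_normed_vector) \<Rightarrow> 'a \<Rightarrow> complex \<Rightarrow> bool" where
  "has_cderiv F D z \<longleftrightarrow> (F has_derivative (\<lambda>h. h *\<^sub>C D)) (at z)"

definition cderiv :: "(complex \<Rightarrow> 'a::complex_normed_vector) \<Rightarrow> complex \<Rightarrow> 'a" where
  "cderiv F z = (THE D. has_cderiv F D z)"

text \<open>Intended for open sets only: the derivative is not taken within the set.\<close>

definition vholomorphic_on :: "(complex \<Rightarrow> 'a::complex_normed_vector) \<Rightarrow> complex set \<Rightarrow> bool" where
  "vholomorphic_on F S \<longleftrightarrow> (\<forall>z\<in>S. \<exists>D. has_cderiv F D z)"

definition maclaurin_coeff :: "(complex \<Rightarrow> 'a::complex_normed_vector) \<Rightarrow> nat \<Rightarrow> 'a" where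
  "maclaurin_coeff F k = inverse (fact k) *\<^sub>R (cderiv ^^ k) F 0"

definition maclaurin_sums_on :: "(complex \<Rightarrow> 'a::complex_normed_vector) \<Rightarrow> complex set \<Rightarrow> bool" where
  "maclaurin_sums_on F S \<longleftrightarrow> (\<forall>z\<in>S. (\<lambda>k. z ^ k *\<^sub>C maclaurin_coeff F k) sums F z)"

text \<open>
  \<open>has_laurent_series F a z0\<close>: on a punctured disc around \<open>z0\<close>, the function \<open>F\<close> is the sum of
  \<open>a j * (z - z0) ^ j\<close> over all integers \<open>j\<close>, regular and principal part converging separately.
\<close>

definition has_laurent_series ::
    "(complex \<Rightarrow> 'a::complex_normed_vector) \<Rightarrow> (int \<Rightarrow> 'a) \<Rightarrow> complex \<Rightarrow> bool" where
  "has_laurent_series F a z0 \<longleftrightarrow>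
     (\<exists>r>0. \<forall>z. 0 < dist z z0 \<and> dist z z0 < r \<longrightarrow>
        (\<exists>R S. (\<lambda>n. (z - z0) ^ n *\<^sub>C a (int n)) sums R \<and>
               (\<lambda>n. inverse (z - z0) ^ Suc n *\<^sub>C a (- int (Suc n))) sums S \<and>
               F z = R + S))"

definition has_pole_of_order :: "(complex \<Rightarrow> 'a::complex_normed_vector) \<Rightarrow> complex \<Rightarrow> nat \<Rightarrow> bool" where
  "has_pole_of_order F z0 m \<longleftrightarrow> m \<ge> 1 \<and>
     (\<exists>a. has_laurent_series F a z0 \<and> a (- int m) \<noteq> 0 \<and> (\<forall>j < - int m. a j = 0))"

abbreviation has_simple_pole :: "(complex \<Rightarrow> 'a::complex_normed_vector) \<Rightarrow> complex \<Rightarrow> bool" where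
  "has_simple_pole F z0 \<equiv> has_pole_of_order F z0 1"

text \<open>
  \<open>H\<close> is, on the open set \<open>D\<close>, a holomorphic continuation of the nonnegative-index part of the
  series with coefficients \<open>a\<close> around \<open>z0\<close>. For connected \<open>D\<close> containing \<open>z0\<close> it is unique on \<open>D\<close>.
\<close>

definition continues_regular_part ::
    "(complex \<Rightarrow> 'a::complex_normed_vector) \<Rightarrow> (int \<Rightarrow> 'a) \<Rightarrow> complex \<Rightarrow> complex set \<Rightarrow> bool" where
  "continues_regular_part H a z0 D \<longleftrightarrow> vholomorphic_on H D \<and>
     (\<exists>r>0. \<forall>z\<in>ball z0 r. (\<lambda>n. (z - z0) ^ n *\<^sub>C a (int n)) sums H z)"

section \<open>Finite powers of a normed space\<close>

text \<open>
  \<open>('b, 'p) power_space\<close> is the \<open>CARD('p)\<close>-fold power of \<open>'b\<close>. The type \<open>'p\<close> only serves to carry the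
  exponent; the coordinates are numbered from \<open>1\<close> to \<open>CARD('p)\<close>.
\<close>

typedef (overloaded) ('b::zero, 'p::finite) power_space =
  "{x :: nat \<Rightarrow> 'b. \<forall>j. j \<notin> {1..CARD('p)} \<longrightarrow> x j = 0}"
  morphisms coord Abs_power_space
  by (rule exI[of _ "\<lambda>_. 0"]) simp

setup_lifting type_definition_power_space

lemma coord_outside: "j \<notin> {1..CARD('p)} \<Longrightarrow> coord (x :: ('b::zero, 'p::finite) power_space) j = 0"
  using coord[of x] by blast

lemma power_space_eqI:
  fixes x y :: "('b::zero, 'p::finite) power_space"
  assumes "\<And>j. j \<in> {1..CARD('p)} \<Longrightarrow> coord x j = coord y j"
  shows "x = y"
proof -
  have "coord x j = coord y j" for j
    using assms[of j] coord_outside[of j x] coord_outside[of j y] by metis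
  then show ?thesis by (auto simp flip: coord_inject)
qed

instantiation power_space :: (real_normed_vector, finite) real_normed_vector
begin

lift_definition zero_power_space :: "('a, 'b) power_space" is "\<lambda>_. 0" by simp

lift_definition plus_power_space :: "('a, 'b) power_space \<Rightarrow> ('a, 'b) power_space \<Rightarrow> ('a, 'b) power_space"
  is "\<lambda>x y j. x j + y j" by simp

lift_definition minus_power_space :: "('a, 'b) power_space \<Rightarrow> ('a, 'b) power_space \<Rightarrow> ('a, 'b) power_space"
  is "\<lambda>x y j. x j - y j" by simp

lift_definition uminus_power_space :: "('a, 'b) power_space \<Rightarrow> ('a, 'b) power_space"
  is "\<lambda>x j. - x j" by simp

lift_definition scaleR_power_space :: "real \<Rightarrow> ('a, 'b) power_space \<Rightarrow> ('a, 'b) power_space"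
  is "\<lambda>r x j. r *\<^sub>R x j" by simp

definition norm_power_space :: "('a, 'b) power_space \<Rightarrow> real" where
  "norm_power_space x = (\<Sum>j = 1..CARD('b). norm (coord x j))"

definition sgn_power_space :: "('a, 'b) power_space \<Rightarrow> ('a, 'b) power_space" where
  "sgn_power_space x = inverse (norm x) *\<^sub>R x"

definition dist_power_space :: "('a, 'b) power_space \<Rightarrow> ('a, 'b) power_space \<Rightarrow> real" where
  "dist_power_space x y = norm (x - y)"

definition uniformity_power_space :: "(('a, 'b) power_space \<times> ('a, 'b) power_space) filter" where
  "uniformity_power_space = (INF e\<in>{0 <..}. principal {(x, y). dist x y < e})"

definition open_power_space :: "('a, 'b) power_space set \<Rightarrow> bool" where
  "open_power_space S \<longleftrightarrow> (\<forall>x\<in>S. \<forall>\<^sub>F (x', y) in uniformity. x' = x \<longrightarrow> y \<in> S)"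

instance
proof
  fix a b :: real and x y z :: "('a, 'b) power_space"
  show "x + y + z = x + (y + z)" by transfer (simp add: add.assoc)
  show "x + y = y + x" by transfer (simp add: add.commute)
  show "0 + x = x" by transfer simp
  show "- x + x = 0" by transfer simp
  show "x - y = x + - y" by transfer simp
  show "a *\<^sub>R (x + y) = a *\<^sub>R x + a *\<^sub>R y" by transfer (simp add: scaleR_add_right)
  show "(a + b) *\<^sub>R x = a *\<^sub>R x + b *\<^sub>R x" by transfer (simp add: scaleR_add_left)
  show "a *\<^sub>R b *\<^sub>R x = (a * b) *\<^sub>R x" by transfer simp
  show "1 *\<^sub>R x = x" by transfer simp
  show "sgn x = inverse (norm x) *\<^sub>R x" by (rule sgn_power_space_def)
  show "dist x y = norm (x - y)" by (rule dist_power_space_def)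
  show "norm (x + y) \<le> norm x + norm y"
    unfolding norm_power_space_def plus_power_space.rep_eq sum.distrib[symmetric]
    by (intro sum_mono norm_triangle_ineq)
  show "norm (a *\<^sub>R x) = \<bar>a\<bar> * norm x"
    by (simp add: norm_power_space_def scaleR_power_space.rep_eq sum_distrib_left)
  show "norm x = 0 \<longleftrightarrow> x = 0"
  proof
    assume "norm x = 0"
    then have "\<forall>j\<in>{1..CARD('b)}. coord x j = 0"
      by (simp add: norm_power_space_def sum_nonneg_eq_0_iff)
    then show "x = 0"
      by (intro power_space_eqI) (simp add: zero_power_space.rep_eq)
  qed (simp add: norm_power_space_def zero_power_space.rep_eq)
qed (simp_all add: uniformity_power_space_def open_power_space_def)

end

instantiation power_space :: (complex_normed_vector, finite) complex_normed_vector
begin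

lift_definition scaleC_power_space :: "complex \<Rightarrow> ('a, 'b) power_space \<Rightarrow> ('a, 'b) power_space"
  is "\<lambda>c x j. c *\<^sub>C x j"
  using linear_0[OF bounded_linear.linear[OF bounded_linear_scaleC]] by auto

instance
proof
  fix c d :: complex and r :: real and x y :: "('a, 'b) power_space"
  show "c *\<^sub>C (x + y) = c *\<^sub>C x + c *\<^sub>C y" by transfer (simp add: scaleC_add_right)
  show "(c + d) *\<^sub>C x = c *\<^sub>C x + d *\<^sub>C x" by transfer (simp add: scaleC_add_left)
  show "c *\<^sub>C d *\<^sub>C x = (c * d) *\<^sub>C x" by transfer (simp add: scaleC_scaleC)
  show "complex_of_real r *\<^sub>C x = r *\<^sub>R x" by transfer (simp add: scaleC_of_real)
  show "norm (c *\<^sub>C x) = cmod c * norm x"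
    by (simp add: norm_power_space_def scaleC_power_space.rep_eq norm_scaleC sum_distrib_left)
qed

end

lemma norm_coord_le: "norm (coord x j) \<le> norm (x :: ('b::real_normed_vector, 'p::finite) power_space)"
proof (cases "j \<in> {1..CARD('p)}")
  case True
  then show ?thesis
    unfolding norm_power_space_def
    by (intro member_le_sum[where f = "\<lambda>j. norm (coord x j)"]) auto
next
  case False
  show ?thesis
    unfolding coord_outside[OF False] norm_zero by (rule norm_ge_zero)
qed

lemma bounded_linear_coord:
  "bounded_linear (\<lambda>x :: ('b::real_normed_vector, 'p::finite) power_space. coord x j)"
  by (rule bounded_linear_intro[where K = 1])
    (simp_all add: plus_power_space.rep_eq scaleR_power_space.rep_eq norm_coord_le)

instance power_space :: (banach, finite) banach
proof
  fix X :: "nat \<Rightarrow> ('a, 'b) power_space"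
  assume "Cauchy X"
  then have "Cauchy (\<lambda>n. coord (X n) j)" for j
    by (rule bounded_linear.Cauchy[OF bounded_linear_coord])
  then have conv: "(\<lambda>n. coord (X n) j) \<longlonglongrightarrow> lim (\<lambda>n. coord (X n) j)" for j
    unfolding convergent_LIMSEQ_iff[symmetric] by (rule Cauchy_convergent)
  define L :: "('a, 'b) power_space" where
    "L = Abs_power_space (\<lambda>j. if j \<in> {1..CARD('b)} then lim (\<lambda>n. coord (X n) j) else 0)"
  have L: "coord L j = lim (\<lambda>n. coord (X n) j)" if "j \<in> {1..CARD('b)}" for j
    using that by (simp add: L_def Abs_power_space_inverse)
  have "(\<lambda>n. \<Sum>j = 1..CARD('b). norm (coord (X n) j - coord L j)) \<longlonglongrightarrow> (\<Sum>j = 1..CARD('b). 0)"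
  proof (intro tendsto_sum tendsto_norm_zero)
    fix j assume "j \<in> {1..CARD('b)}"
    from conv[of j] show "(\<lambda>n. coord (X n) j - coord L j) \<longlonglongrightarrow> 0"
      unfolding L[OF \<open>j \<in> _\<close>] by (rule LIM_zero)
  qed
  then have "(\<lambda>n. norm (X n - L)) \<longlonglongrightarrow> 0"
    by (simp add: norm_power_space_def minus_power_space.rep_eq)
  then show "convergent X"
    by (rule convergentI[OF LIM_zero_cancel[OF tendsto_norm_zero_cancel]])
qed

instance power_space :: (complex_banach, finite) complex_banach ..

section \<open>Autoregressive pencils\<close>

definition ar_pencil ::
    "nat \<Rightarrow> (nat \<Rightarrow> ('b::complex_normed_vector \<Rightarrow>\<^sub>L 'b)) \<Rightarrow> complex \<Rightarrow> ('b \<Rightarrow>\<^sub>L 'b)" where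
  "ar_pencil p \<Phi> z = id_blinfun - (\<Sum>j = 1..p. z ^ j *\<^sub>C \<Phi> j)"

definition unit_root :: "(complex \<Rightarrow> ('b::complex_normed_vector \<Rightarrow>\<^sub>L 'b)) \<Rightarrow> bool" where
  "unit_root A \<longleftrightarrow>
     (\<exists>\<eta>>0. spectrum_of A \<inter> ball 0 (1 + \<eta>) = {1}) \<and> A 1 \<noteq> 0 \<and>
     (\<exists>V. space_is_direct_sum (ran_op (A 1)) V) \<and> (\<exists>W. space_is_direct_sum (ker_op (A 1)) W)"

lift_definition companion_map ::
    "(nat \<Rightarrow> ('b::real_normed_vector \<Rightarrow>\<^sub>L 'b)) \<Rightarrow> ('b, 'p::finite) power_space \<Rightarrow> ('b, 'p) power_space"
  is "\<lambda>\<Phi> x i. if i = 1 then \<Sum>j = 1..CARD('p). blinfun_apply (\<Phi> j) (x j)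
              else if i \<in> {2..CARD('p)} then x (i - 1) else 0"
  by (auto simp: Suc_le_eq)

lift_definition companion ::
    "(nat \<Rightarrow> ('b::real_normed_vector \<Rightarrow>\<^sub>L 'b)) \<Rightarrow> ('b, 'p::finite) power_space \<Rightarrow>\<^sub>L ('b, 'p) power_space"
  is companion_map
proof -
  fix \<Phi> :: "nat \<Rightarrow> ('b \<Rightarrow>\<^sub>L 'b)"
  let ?T = "companion_map \<Phi> :: ('b, 'p) power_space \<Rightarrow> ('b, 'p) power_space"
  let ?M = "\<Sum>j = 1..CARD('p). norm (\<Phi> j)"
  show "bounded_linear ?T"
  proof (rule bounded_linear_intro[where K = "real CARD('p) * (?M + 1)"])
    fix x y :: "('b, 'p) power_space" and r :: real
    show "?T (x + y) = ?T x + ?T y"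
      by (rule power_space_eqI)
        (simp add: companion_map.rep_eq plus_power_space.rep_eq blinfun.add_right sum.distrib)
    show "?T (r *\<^sub>R x) = r *\<^sub>R ?T x"
      by (rule power_space_eqI)
        (simp add: companion_map.rep_eq scaleR_power_space.rep_eq blinfun.scaleR_right scaleR_sum_right)
    have M: "?M \<ge> 0" by (simp add: sum_nonneg)
    have "norm (\<Sum>j = 1..CARD('p). blinfun_apply (\<Phi> j) (coord x j)) \<le> ?M * norm x"
      unfolding sum_distrib_right
      by (intro order_trans[OF norm_sum] sum_mono order_trans[OF norm_blinfun]
          mult_left_mono norm_coord_le) simp
    moreover have "norm (coord x i) \<le> (?M + 1) * norm x" for i
    proof -
      have "1 * norm x \<le> (?M + 1) * norm x"
        using M by (intro mult_right_mono) simp_all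
      then show ?thesis using norm_coord_le[of x i] by simp
    qed
    ultimately have bounds: "norm (\<Sum>j = 1..CARD('p). blinfun_apply (\<Phi> j) (coord x j)) \<le> ?M * norm x"
      "norm (coord x i) \<le> (?M + 1) * norm x" for i by blast+
    have "norm (coord (?T x) i) \<le> (?M + 1) * norm x" for i
    proof -
      have "?M * norm x \<le> (?M + 1) * norm x" "0 \<le> (?M + 1) * norm x"
        using M by (simp_all add: mult_right_mono)
      then show ?thesis
        using order_trans[OF bounds(1)] bounds(2)[of "i - 1"]
        by (simp only: companion_map.rep_eq norm_zero split: if_split) simp
    qed
    then have "norm (?T x) \<le> (\<Sum>i = 1..CARD('p). (?M + 1) * norm x)"
      unfolding norm_power_space_def[of "?T x"] by (intro sum_mono) simp
    then show "norm (?T x) \<le> norm x * (real CARD('p) * (?M + 1))"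
      by (simp add: mult_ac)
  qed
qed

definition companion_pencil ::
    "(nat \<Rightarrow> ('b::complex_normed_vector \<Rightarrow>\<^sub>L 'b)) \<Rightarrow> complex \<Rightarrow>
     (('b, 'p::finite) power_space \<Rightarrow>\<^sub>L ('b, 'p) power_space)" where
  "companion_pencil \<Phi> z = id_blinfun - z *\<^sub>C companion \<Phi>"

end

(*
  Let A(z) = I - z T be the companion pencil. The equation A(z) x = y is solved coordinatewise, which reduces it to
  Phi(z) x_1 = (a combination of the y_i); hence both pencils have the same spectrum.

  If the pole is simple, letting w tend to 0 in (A(1) - w T) A(1 + w)^-1 = I = A(1 + w)^-1 (A(1) - w T)
  gives the identities which make P the projection onto ker A(1) along ran A(1).  Conversely, a
  topological direct sum of range and kernel has a bounded projection P (closed graph theorem), which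
  commutes with T, and S = T - P has the eigenvalue 1 moved to 0: I - z S is invertible on the whole
  disc and A(z)^-1 = (1 - z)^-1 P + (I - z S)^-1 (I - P).  So the pole is simple, the holomorphic part
  is (I - z S)^-1 (I - P), and the Maclaurin series converge because the mean value property of the
  resolvent over circles yields Cauchy estimates for the powers of S.
*)

theory Submission
  imports Defs
begin

section \<open>The closed graph theorem\<close>

text \<open>The claim about Maclaurin series is the hard one: the singular point 1 lies inside the
  disc, and operator norms give no control over the radius of convergence. After deflation nothing
  is known except that an inverse exists at every point of the disc. Convergence is drawn from this
  fact alone: the resolvent identity gives continuity and a derivative of the resolvent, and
  integration over circles turns its boundedness on a circle into bounds for powers. A shift of the
  centre turns one resolvent into another, so a single theorem supplies both the expansion at 0 and
  the expansion at 1. The coefficients N_j are given data, known only through their expansion;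
  uniqueness of Laurent coefficients is what connects them with the construction. Operators are
  real-linear by type, so complex linearity is carried along as a side condition. Inverses and
  projections arise as plain functions, which the closed graph theorem makes bounded.\<close>

lemma UN_closed_interior_nonempty:
  fixes F :: "nat \<Rightarrow> 'a::{complete_space} set"
  assumes "\<And>n. closed (F n)" and "(\<Union>n. F n) = UNIV"
  shows "\<exists>n. interior (F n) \<noteq> {}"
proof (rule ccontr)
  assume "\<not> ?thesis"
  then have "euclidean interior_of \<Union>(range F) = {}"
    using Met_TC.metric_Baire_category_alt[where 'a = 'a, of "range F"] assms(1)
    by (auto simp: complete_UNIV)
  then show False
    using assms(2) by auto
qed

text \<open>Successive approximation: the sublevel sets of \<open>norm \<circ> f\<close> are dense in a ball, so every point of
  the ball is a series whose image series converges geometrically.\<close>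

theorem closed_graph_bounded_linear:
  fixes f :: "'a::banach \<Rightarrow> 'b::banach"
  assumes lin: "linear f"
    and graph: "\<And>X x y. X \<longlonglongrightarrow> x \<Longrightarrow> (\<lambda>n. f (X n)) \<longlonglongrightarrow> y \<Longrightarrow> f x = y"
  shows "bounded_linear f"
proof -
  interpret linear f by fact
  define E where "E n = {x. norm (f x) \<le> real n}" for n :: nat
  have "(\<Union>n. closure (E n)) = UNIV"
  proof (intro UNIV_eq_I[symmetric] UN_I)
    fix x show "x \<in> closure (E (nat \<lceil>norm (f x)\<rceil>))"
      by (rule subsetD[OF closure_subset]) (simp add: E_def of_nat_ceiling)
  qed simp
  then obtain m where "interior (closure (E m)) \<noteq> {}"
    using UN_closed_interior_nonempty[of "\<lambda>n. closure (E n)"] by auto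
  then obtain x0 r where r: "r > 0" "ball x0 r \<subseteq> closure (E m)"
    by (metis all_not_in_conv mem_interior)
  \<comment> \<open>A difference \<open>a - b\<close> of points near \<open>x0 + x\<close> and
    \<open>x0\<close> moves the density from the ball around \<open>x0\<close> to one around 0; the
    bound on the image doubles from \<open>m\<close> to \<open>2 * m\<close>.\<close>
  have small: "\<exists>u. norm (x - u) < e \<and> norm (f u) \<le> 2 * real m" if x: "norm x < r" and "e > 0" for x e
  proof -
    have "x0 + x \<in> closure (E m)" "x0 \<in> closure (E m)"
      using r x by (auto simp: dist_norm)
    then obtain a b where a: "a \<in> E m" "dist a (x0 + x) < e / 2" and b: "b \<in> E m" "dist b x0 < e / 2"
      using \<open>e > 0\<close> by (meson closure_approachable half_gt_zero)
    have "x - (a - b) = (b - x0) - (a - (x0 + x))" by simp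
    then have "norm (x - (a - b)) \<le> norm (b - x0) + norm (a - (x0 + x))"
      by (simp only: norm_triangle_ineq4)
    then have "norm (x - (a - b)) < e"
      using a b by (simp add: dist_norm)
    moreover have "norm (f (a - b)) \<le> 2 * real m"
      using a b norm_triangle_ineq4[of "f a" "f b"] by (simp add: E_def diff)
    ultimately show ?thesis by blast
  qed
  have scaled: "\<exists>u. norm (x - u) < r / 2 ^ Suc n \<and> norm (f u) \<le> 2 * real m / 2 ^ n"
    if "norm x < r / 2 ^ n" for x and n :: nat
  proof -
    have "norm (2 ^ n *\<^sub>R x) < r" using that by (simp add: field_simps)
    then obtain u where u: "norm (2 ^ n *\<^sub>R x - u) < r / 2" "norm (f u) \<le> 2 * real m"
      using small[of "2 ^ n *\<^sub>R x" "r / 2"] r by auto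
    have "x - inverse (2 ^ n) *\<^sub>R u = inverse (2 ^ n) *\<^sub>R (2 ^ n *\<^sub>R x - u)"
      by (simp add: scaleR_diff_right)
    then have "norm (x - inverse (2 ^ n) *\<^sub>R u) = inverse (2 ^ n) * norm (2 ^ n *\<^sub>R x - u)"
      by (simp only: norm_scaleR) simp
    then show ?thesis
      using u by (intro exI[of _ "inverse (2 ^ n) *\<^sub>R u"]) (simp add: scale field_simps)
  qed
  have bound: "norm (f x) \<le> 4 * real m" if x: "norm x < r" for x
  proof -
    define g where
      "g n y = (SOME u. norm (y - u) < r / 2 ^ Suc n \<and> norm (f u) \<le> 2 * real m / 2 ^ n)"
      for n :: nat and y
    have g: "norm (y - g n y) < r / 2 ^ Suc n" "norm (f (g n y)) \<le> 2 * real m / 2 ^ n"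
      if "norm y < r / 2 ^ n" for y n
      using someI_ex[OF scaled[OF that]] by (simp_all add: g_def)
    \<comment> \<open>\<open>y n\<close> is what remains of \<open>x\<close> after \<open>n\<close>
      corrections; the corrections \<open>u n\<close> telescope to \<open>x - y n\<close>.\<close>
    define y where "y = rec_nat x (\<lambda>n y. y - g n y)"
    have y: "norm (y n) < r / 2 ^ n" for n
      by (induction n) (use x g in \<open>auto simp: y_def\<close>)
    define u where "u n = g n (y n)" for n
    have "(\<Sum>k<n. u k) = x - y n" for n
      by (induction n) (auto simp: y_def u_def)
    moreover have "y \<longlonglongrightarrow> 0"
    proof (rule Lim_null_comparison)
      show "\<forall>\<^sub>F n in sequentially. norm (y n) \<le> r * (1 / 2) ^ n"
        using y by (auto simp: power_divide less_imp_le)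
      show "(\<lambda>n. r * (1 / 2) ^ n) \<longlonglongrightarrow> 0"
        by (intro tendsto_mult_right_zero LIMSEQ_power_zero) simp
    qed
    ultimately have u_lim: "(\<lambda>n. \<Sum>k<n. u k) \<longlonglongrightarrow> x"
      using tendsto_diff[OF tendsto_const[of x], of y 0 sequentially] by simp
    have fu: "norm (f (u n)) \<le> 2 * real m * (1 / 2) ^ n" for n
      using g[OF y] by (simp add: u_def power_divide)
    have geo: "(\<lambda>n. 2 * real m * (1 / 2) ^ n) sums (2 * real m * 2)"
      using sums_mult[OF geometric_sums[of "1 / 2 :: real"], of "2 * real m"] by simp
    have "summable (\<lambda>n. f (u n))"
      by (rule summable_comparison_test'[OF sums_summable[OF geo] fu])
    then have "(\<lambda>n. \<Sum>k<n. f (u k)) \<longlonglongrightarrow> (\<Sum>n. f (u n))"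
      by (rule summable_LIMSEQ)
    \<comment> \<open>Here the graph hypothesis enters: the partial sums converge to
      \<open>x\<close>, and their images converge by absolute summability.\<close>
    then have "f x = (\<Sum>n. f (u n))"
      using graph[OF u_lim] by (simp add: sum)
    also have "norm \<dots> \<le> (\<Sum>n. 2 * real m * (1 / 2) ^ n)"
      by (rule norm_suminf_le[OF fu sums_summable[OF geo]])
    finally show ?thesis
      using sums_unique[OF geo] by simp
  qed
  show ?thesis
  \<comment> \<open>The bound \<open>4 * m\<close> on the ball of radius \<open>r\<close> is tested
    at a multiple of \<open>x\<close> of norm \<open>r / 2\<close>, whence
    \<open>8 * m / r\<close>.\<close>
  proof (rule bounded_linear_intro[where K = "8 * real m / r"])
    fix x :: 'a
    show "norm (f x) \<le> norm x * (8 * real m / r)"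
    proof (cases "x = 0")
      case False
      define c where "c = r / (2 * norm x)"
      have c: "c > 0" "norm (c *\<^sub>R x) < r"
        using False r by (auto simp: c_def)
      have "c * norm (f x) \<le> 4 * real m"
        using bound[OF c(2)] c(1) by (simp add: scale)
      then show ?thesis
        using False r by (simp add: c_def field_simps)
    qed simp
  qed (simp_all add: add scale)
qed

section \<open>Operators on complex Banach spaces\<close>

lemma scaleC_one [simp]: "1 *\<^sub>C x = x"
  using scaleC_of_real[of 1 x] by simp

instance blinfun :: (real_normed_vector, complex_banach) complex_banach ..

lemma bounded_bilinear_scaleC:
  "bounded_bilinear (\<lambda>c (x::'a::complex_normed_vector). c *\<^sub>C x)"
proof
  fix a a' :: complex and x x' :: 'a and r :: real
  show "(a + a') *\<^sub>C x = a *\<^sub>C x + a' *\<^sub>C x" by (rule scaleC_add_left)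
  show "a *\<^sub>C (x + x') = a *\<^sub>C x + a *\<^sub>C x'" by (rule scaleC_add_right)
  show "(r *\<^sub>R a) *\<^sub>C x = r *\<^sub>R a *\<^sub>C x"
    by (simp add: scaleC_of_real[symmetric] scaleC_scaleC scaleR_conv_of_real)
  show "a *\<^sub>C r *\<^sub>R x = r *\<^sub>R a *\<^sub>C x"
    by (simp add: scaleC_of_real[symmetric] scaleC_scaleC mult.commute)
  show "\<exists>K. \<forall>a x::'a. norm (a *\<^sub>C x) \<le> norm a * norm x * K"
    by (intro exI[of _ 1]) (simp add: norm_scaleC)
qed

interpretation scaleC: bounded_bilinear "\<lambda>c (x::'a::complex_normed_vector). c *\<^sub>C x"
  by (rule bounded_bilinear_scaleC)

interpretation compose: bounded_bilinear "blinfun_compose"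
  by (rule bounded_bilinear_blinfun_compose)

lemma scaleC_compose: "(c *\<^sub>C A) o\<^sub>L B = c *\<^sub>C (A o\<^sub>L B)"
  by (rule blinfun_eqI) (simp add: scaleC_blinfun.rep_eq)

lemma compose_scaleC: "clinear_op A \<Longrightarrow> A o\<^sub>L (c *\<^sub>C B) = c *\<^sub>C (A o\<^sub>L B)"
  by (rule blinfun_eqI) (simp add: scaleC_blinfun.rep_eq clinear_op_def)

lemma id_blinfun_compose [simp]: "id_blinfun o\<^sub>L A = A" "A o\<^sub>L id_blinfun = A"
  by (auto intro: blinfun_eqI)

lemma compose_assoc: "(A o\<^sub>L B) o\<^sub>L C = A o\<^sub>L (B o\<^sub>L C)"
  by (auto intro: blinfun_eqI)

lemma clinear_op_id [simp]: "clinear_op id_blinfun"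
  by (simp add: clinear_op_def)

lemma clinear_op_diff: "clinear_op A \<Longrightarrow> clinear_op B \<Longrightarrow> clinear_op (A - B)"
  by (simp add: clinear_op_def blinfun.diff_left scaleC.diff_right)

lemma clinear_op_scaleC: "clinear_op A \<Longrightarrow> clinear_op (c *\<^sub>C A)"
  by (simp add: clinear_op_def scaleC_blinfun.rep_eq scaleC_scaleC mult.commute)

lemma clinear_op_compose: "clinear_op A \<Longrightarrow> clinear_op B \<Longrightarrow> clinear_op (A o\<^sub>L B)"
  by (simp add: clinear_op_def)

lemma inverse_op_unique:
  assumes "inverse_op A B" "inverse_op A C"
  shows "B = C"
proof -
  have "B = B o\<^sub>L (A o\<^sub>L C)" using assms by (simp add: inverse_op_def)
  also have "\<dots> = (B o\<^sub>L A) o\<^sub>L C" by (simp only: compose_assoc)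
  also have "\<dots> = C" using assms by (simp add: inverse_op_def)
  finally show ?thesis .
qed

lemma op_inv_eqI: "inverse_op A B \<Longrightarrow> op_inv A = B"
  unfolding op_inv_def by (rule the_equality) (auto intro: inverse_op_unique)

lemma inverse_op_op_inv: "invertible_op A \<Longrightarrow> inverse_op A (op_inv A)"
  unfolding invertible_op_def by (auto simp: op_inv_eqI)

text \<open>Complex linearity of \<open>B\<close> is inherited from \<open>A\<close>: apply
  \<open>B\<close> to \<open>A (c *\<^sub>C B x) = c *\<^sub>C x\<close>.\<close>

lemma inverse_opI:
  assumes "clinear_op A" and AB: "A o\<^sub>L B = id_blinfun" and BA: "B o\<^sub>L A = id_blinfun"
  shows "inverse_op A B"
proof -
  have A: "A (c *\<^sub>C x) = c *\<^sub>C A x" for c x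
    using assms(1) by (simp add: clinear_op_def)
  have AB': "A (B x) = x" and BA': "B (A x) = x" for x
    using AB BA by (simp_all flip: blinfun_apply_blinfun_compose)
  have "B (c *\<^sub>C x) = c *\<^sub>C B x" for c x
    using BA'[of "c *\<^sub>C B x"] by (simp add: A AB')
  then show ?thesis
    using AB BA by (simp add: inverse_op_def clinear_op_def)
qed

lemma inverse_op_apply:
  assumes "inverse_op A B"
  shows "A (B x) = x" "B (A x) = x"
  using assms by (simp_all add: inverse_op_def flip: blinfun_apply_blinfun_compose)

text \<open>Bounded inverse theorem: the graph of the inverse is the graph of \<open>A\<close> with
  its coordinates swapped, hence closed. Comparing spectra thereby becomes a question of unique
  solvability.\<close>

lemma invertible_op_iff_bij:
  fixes A :: "'a::complex_banach \<Rightarrow>\<^sub>L 'a"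
  assumes "clinear_op A"
  shows "invertible_op A \<longleftrightarrow> bij (blinfun_apply A)"
proof
  assume "invertible_op A"
  then show "bij (blinfun_apply A)"
    using inverse_op_op_inv[of A] inverse_op_apply[of A] by (intro o_bij[of "op_inv A"]) auto
next
  assume bij: "bij (blinfun_apply A)"
  have linear_inv: "linear (inv (blinfun_apply A))"
    by (rule linearI; rule inv_f_eq[OF bij_is_inj[OF bij]])
      (simp_all add: blinfun.add_right blinfun.scaleR_right surj_f_inv_f[OF bij_is_surj[OF bij]])
  have "bounded_linear (inv (blinfun_apply A))"
  proof (rule closed_graph_bounded_linear)
    fix X x y
    assume X: "X \<longlonglongrightarrow> x" and Y: "(\<lambda>n. inv (blinfun_apply A) (X n)) \<longlonglongrightarrow> y"
    have "(\<lambda>n. A (inv (blinfun_apply A) (X n))) \<longlonglongrightarrow> A y"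
      using Y by (intro tendsto_intros)
    then have "A y = x"
      using X bij by (simp add: bij_is_surj surj_f_inv_f LIMSEQ_unique)
    then show "inv (blinfun_apply A) x = y"
      using bij by (auto simp: bij_is_inj)
  qed (rule linear_inv)
  then have "blinfun_apply (Blinfun (inv (blinfun_apply A))) = inv (blinfun_apply A)"
    by (rule bounded_linear_Blinfun_apply)
  then have "inverse_op A (Blinfun (inv (blinfun_apply A)))"
    using bij
    by (intro inverse_opI assms blinfun_eqI) (auto simp: bij_is_surj bij_is_inj surj_f_inv_f)
  then show "invertible_op A"
    unfolding invertible_op_def by blast
qed

section \<open>Closed direct sums and bounded projections\<close>

lemma closed_csubspace_ker_op:
  assumes "clinear_op A"
  shows "closed_csubspace (ker_op A)"
proof -
  have "ker_op A = blinfun_apply A -` {0}" by (auto simp: ker_op_def)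
  then have "closed (ker_op A)"
    by (simp add: continuous_closed_vimage blinfun.bounded_linear_right linear_continuous_at)
  then show ?thesis
    using assms
    by (auto simp: closed_csubspace_def ker_op_def blinfun.add_right clinear_op_def scaleC.zero_right)
qed

text \<open>Both summands are closed as kernels of bounded operators: \<open>V\<close> is the kernel
  of \<open>P\<close>, and \<open>U\<close> that of \<open>id_blinfun - P\<close>.\<close>

lemma projection_direct_sum:
  assumes "projection_onto_along P U V"
  shows "space_is_direct_sum V U"
proof -
  have P: "clinear_op P" "P o\<^sub>L P = P" "range P = U" "V = ker_op P"
    using assms by (auto simp: projection_onto_along_def ran_op_def)
  have PP: "P (P x) = P x" for x
    using P(2) by (metis blinfun_apply_blinfun_compose)
  have U: "U = ker_op (id_blinfun - P)"
    unfolding ker_op_def P(3)[symmetric] by (force simp: blinfun.diff_left PP)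
  have "closed_csubspace U" "closed_csubspace V"
    unfolding U P(4) using P(1) by (auto intro!: closed_csubspace_ker_op clinear_op_diff)
  moreover have "V \<inter> U = {0}"
    unfolding U P(4) by (auto simp: ker_op_def blinfun.diff_left)
  moreover have "\<exists>v\<in>V. \<exists>u\<in>U. x = v + u" for x
    by (rule bexI[of _ "x - P x"], rule bexI[of _ "P x"])
      (use P(3) in \<open>auto simp: P(4) ker_op_def blinfun.diff_right PP\<close>)
  ultimately show ?thesis
    by (simp add: space_is_direct_sum_def)
qed

text \<open>Closedness of the two summands is what closes the graph: if \<open>X n\<close> tends to
  \<open>x\<close> and \<open>f (X n)\<close> to \<open>y\<close>, then \<open>y\<close> is in
  \<open>U\<close> and \<open>x - y\<close> in \<open>V\<close>, so \<open>y\<close> is the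
  \<open>U\<close>-component of \<open>x\<close>.\<close>

lemma direct_sum_projection:
  fixes U V :: "'a::complex_banach set"
  assumes "space_is_direct_sum V U"
  shows "\<exists>P. projection_onto_along P U V"
proof -
  have U: "closed U" "0 \<in> U" "\<And>x y. x \<in> U \<Longrightarrow> y \<in> U \<Longrightarrow> x + y \<in> U" "\<And>c x. x \<in> U \<Longrightarrow> c *\<^sub>C x \<in> U"
    and V: "closed V" "0 \<in> V" "\<And>x y. x \<in> V \<Longrightarrow> y \<in> V \<Longrightarrow> x + y \<in> V" "\<And>c x. x \<in> V \<Longrightarrow> c *\<^sub>C x \<in> V"
    and UV: "V \<inter> U = {0}" "\<And>x. \<exists>v\<in>V. \<exists>u\<in>U. x = v + u"
    using assms unfolding space_is_direct_sum_def closed_csubspace_def by auto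
  have "\<exists>u. u \<in> U \<and> x - u \<in> V" for x
    using UV(2)[of x] by force
  then obtain f where f: "f x \<in> U" "x - f x \<in> V" for x
    by metis
  have f_eq: "f x = u" if "u \<in> U" "x - u \<in> V" for x u
  proof -
    have "f x - u \<in> U"
      using U(3)[OF f(1)[of x] U(4)[OF that(1), of "-1"]] by (simp add: scaleC.minus_left)
    moreover have "(x - u) + (-1) *\<^sub>C (x - f x) \<in> V"
      by (intro V f that)
    then have "f x - u \<in> V"
      by (simp add: scaleC.minus_left)
    ultimately have "f x - u \<in> V \<inter> U" by blast
    then show ?thesis
      unfolding UV(1) by simp
  qed
  have f_scaleC: "f (c *\<^sub>C x) = c *\<^sub>C f x" for c x
    using V(4)[OF f(2)[of x], of c] by (intro f_eq U f) (simp add: scaleC.diff_right)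
  have "linear f"
  proof
    fix x y :: 'a and r :: real
    show "f (x + y) = f x + f y"
      using V(3)[OF f(2)[of x] f(2)[of y]] by (intro f_eq U f) (simp add: algebra_simps)
    show "f (r *\<^sub>R x) = r *\<^sub>R f x"
      using f_scaleC[of "complex_of_real r" x] by (simp add: scaleC_of_real)
  qed
  moreover have "f x = y" if X: "X \<longlonglongrightarrow> x" and Y: "(\<lambda>n. f (X n)) \<longlonglongrightarrow> y" for X x y
  proof (rule f_eq)
    show "y \<in> U"
      by (rule closed_sequentially[OF U(1) _ Y]) (rule f)
    show "x - y \<in> V"
      by (rule closed_sequentially[OF V(1) _ tendsto_diff[OF X Y]]) (rule f)
  qed
  ultimately have "bounded_linear f"
    by (rule closed_graph_bounded_linear)
  then have P: "blinfun_apply (Blinfun f) = f"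
    by (rule bounded_linear_Blinfun_apply)
  have fU: "f u = u" if "u \<in> U" for u
    using that V(2) by (intro f_eq) auto
  have "projection_onto_along (Blinfun f) U V"
    unfolding projection_onto_along_def clinear_op_def ran_op_def ker_op_def P
  proof (intro conjI allI)
    show "Blinfun f o\<^sub>L Blinfun f = Blinfun f"
      by (rule blinfun_eqI) (simp add: P fU f)
    show "range f = U"
      using f(1) fU by (auto intro!: image_eqI[OF sym])
    show "{x. f x = 0} = V"
    proof (intro set_eqI)
      fix x show "x \<in> {x. f x = 0} \<longleftrightarrow> x \<in> V"
        using f(2)[of x] f_eq[OF U(2), of x] by auto
    qed
  qed (rule f_scaleC)
  then show ?thesis by blast
qed

section \<open>Power series and Laurent series with vector coefficients\<close>

text \<open>Terms of a convergent series are bounded, so at a smaller radius they are dominated by a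
  geometric series.\<close>

lemma sums_scaleC_norm_summable:
  fixes c :: "nat \<Rightarrow> 'a::complex_normed_vector"
  assumes "summable (\<lambda>n. z ^ n *\<^sub>C c n)" and "0 \<le> r" and "r < cmod z"
  shows "summable (\<lambda>n. norm (c n) * r ^ n)"
proof -
  have "Bseq (\<lambda>n. z ^ n *\<^sub>C c n)"
    using assms(1) by (intro convergent_imp_Bseq convergentI[OF summable_LIMSEQ_zero])
  then obtain M where "\<forall>n. norm (z ^ n *\<^sub>C c n) \<le> M"
    by (rule BseqE)
  then have "norm (c n) * cmod z ^ n \<le> M" for n
    by (simp add: norm_scaleC norm_power mult.commute)
  then show ?thesis
    using assms(2,3) by (rule Abel_lemma[rotated 2])
qed

lemma has_cderiv_cderiv: "has_cderiv F D z \<Longrightarrow> cderiv F z = D"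
  unfolding cderiv_def has_cderiv_def
  by (rule the_equality) (use has_derivative_unique in \<open>force dest: fun_cong[where x = 1]\<close>)+

lemma has_cderiv_power_series:
  fixes c :: "nat \<Rightarrow> 'a::complex_banach"
  assumes F: "\<And>z. z \<in> ball 0 \<rho> \<Longrightarrow> (\<lambda>n. z ^ n *\<^sub>C c n) sums F z"
    and z: "z \<in> ball 0 \<rho>"
  shows "\<exists>D. has_cderiv F D z \<and> (\<lambda>n. z ^ n *\<^sub>C of_nat (Suc n) *\<^sub>C c (Suc n)) sums D"
proof -
  \<comment> \<open>Two radii are put between \<open>cmod z\<close> and \<open>\<rho>\<close>:
    absolute convergence is first obtained below \<open>s'\<close>, and the gap between
    \<open>s\<close> and \<open>s'\<close> pays for the factor \<open>n\<close> that differentiation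
    adds.\<close>
  obtain s where s: "cmod z < s" "s < \<rho>"
    using z dense by auto
  obtain s' where s': "s < s'" "s' < \<rho>"
    using s dense by blast
  have s0: "0 \<le> s" "0 \<le> s'" using s s' norm_ge_zero[of z] by linarith+
  have "summable (\<lambda>n. norm (c n) * x ^ n)" if "norm x < s'" for x :: real
  proof -
    have "summable (\<lambda>n. norm (c n) * \<bar>x\<bar> ^ n)"
      using that s' F[of "of_real s'"] s0
      by (intro sums_scaleC_norm_summable[where z = "of_real s'"]) (auto intro: sums_summable)
    then show ?thesis
      by (rule summable_norm_cancel[OF summable_cong[THEN iffD2], rotated])
        (simp add: abs_mult power_abs)
  qed
  then have "summable (\<lambda>n. diffs (\<lambda>n. norm (c n)) n * s ^ n)"
    using s' s0 by (intro termdiff_converges[where K = s']) auto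
  then have summ: "summable (\<lambda>n. s ^ n * (real (Suc n) * norm (c (Suc n))))"
    by (simp add: diffs_def mult_ac)
  \<comment> \<open>At \<open>n = 0\<close> the truncated exponent \<open>n - 1\<close> does no
    harm, since the factor \<open>of_nat n\<close> vanishes.\<close>
  define f' where "f' n x = (of_nat n * x ^ (n - 1)) *\<^sub>C c n" for n x
  have f'_Suc: "f' (Suc n) x = x ^ n *\<^sub>C of_nat (Suc n) *\<^sub>C c (Suc n)" for n x
    by (simp add: f'_def scaleC_scaleC mult.commute)
  define M where "M n = s ^ (n - 1) * (real n * norm (c n))" for n
  have "summable M"
    by (subst summable_Suc_iff[symmetric]) (use summ in \<open>simp add: M_def\<close>)
  moreover have f'_M: "norm (f' n x) \<le> M n" if "x \<in> ball 0 s" for n x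
  proof -
    have "norm (f' n x) = cmod x ^ (n - 1) * (real n * norm (c n))"
      by (simp add: f'_def norm_scaleC norm_mult norm_power mult_ac)
    also have "\<dots> \<le> M n"
      unfolding M_def using that by (intro mult_right_mono power_mono) auto
    finally show ?thesis .
  qed
  ultimately have unif: "uniform_limit (ball 0 s) (\<lambda>n x. \<Sum>i<n. f' i x) (\<lambda>x. \<Sum>i. f' i x) sequentially"
    by (intro Weierstrass_m_test) auto
  have zs: "z \<in> ball 0 s" using s by simp
  have "summable (\<lambda>n. f' n z)"
    by (rule summable_comparison_test'[OF \<open>summable M\<close> f'_M[OF zs]])
  moreover have f'0: "f' 0 z = 0" by (simp add: f'_def scaleC.zero_left)
  ultimately have D: "(\<lambda>n. z ^ n *\<^sub>C of_nat (Suc n) *\<^sub>C c (Suc n)) sums (\<Sum>i. f' i z)"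
    using sums_Suc_iff[of "\<lambda>n. f' n z" "\<Sum>i. f' i z"] by (simp add: f'_Suc summable_sums)
  have "\<exists>g. \<forall>x\<in>ball 0 s. (\<lambda>n. x ^ n *\<^sub>C c n) sums g x \<and>
      (g has_derivative (\<lambda>h. h *\<^sub>C (\<Sum>i. f' i x))) (at x within ball 0 s)"
  proof (rule has_derivative_series[where f' = "\<lambda>n x h. h *\<^sub>C f' n x"])
    fix n :: nat and x :: complex
    have "((\<lambda>x. x ^ n) has_derivative (\<lambda>h. h * (of_nat n * x ^ (n - 1)))) (at x within ball 0 s)"
      by (auto intro!: derivative_eq_intros)
    from bounded_linear.has_derivative[OF scaleC.bounded_linear_left this]
    show "((\<lambda>x. x ^ n *\<^sub>C c n) has_derivative (\<lambda>h. h *\<^sub>C f' n x)) (at x within ball 0 s)"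
      by (simp add: f'_def scaleC_scaleC)
  next
    fix e :: real assume "e > 0"
    show "\<forall>\<^sub>F n in sequentially. \<forall>x\<in>ball 0 s. \<forall>h.
        norm ((\<Sum>i<n. h *\<^sub>C f' i x) - h *\<^sub>C (\<Sum>i. f' i x)) \<le> e * norm h"
      using uniform_limitD[OF unif \<open>e > 0\<close>]
    proof eventually_elim
      case (elim n)
      show ?case
      proof (intro ballI allI)
        fix x h :: complex assume "x \<in> ball 0 s"
        then have "norm ((\<Sum>i<n. f' i x) - (\<Sum>i. f' i x)) \<le> e"
          using elim by (auto simp: dist_norm intro: less_imp_le)
        then have "norm h * norm ((\<Sum>i<n. f' i x) - (\<Sum>i. f' i x)) \<le> norm h * e"
          by (rule mult_left_mono) simp
        then show "norm ((\<Sum>i<n. h *\<^sub>C f' i x) - h *\<^sub>C (\<Sum>i. f' i x)) \<le> e * norm h"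
          by (simp add: scaleC.sum_right[symmetric] scaleC.diff_right[symmetric] norm_scaleC mult.commute)
      qed
    qed
  next
    show "(\<lambda>n. z ^ n *\<^sub>C c n) sums F z" by (rule F[OF z])
  qed (use zs in auto)
  then obtain g where g: "\<And>x. x \<in> ball 0 s \<Longrightarrow> (\<lambda>n. x ^ n *\<^sub>C c n) sums g x"
      "(g has_derivative (\<lambda>h. h *\<^sub>C (\<Sum>i. f' i z))) (at z within ball 0 s)"
    using zs by blast
  have "g x = F x" if "x \<in> ball 0 s" for x
    using g(1)[OF that] F[of x] s that by (auto dest: sums_unique2)
  then have "(F has_derivative (\<lambda>h. h *\<^sub>C (\<Sum>i. f' i z))) (at z within ball 0 s)"
    using g(2) zs by (metis (mono_tags, lifting) has_derivative_transform)
  then have "has_cderiv F (\<Sum>i. f' i z) z"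
    unfolding has_cderiv_def using at_within_open[OF zs] by simp
  then show ?thesis using D by blast
qed

lemma power_series_vholomorphic:
  fixes c :: "nat \<Rightarrow> 'a::complex_banach"
  assumes "\<And>z. z \<in> ball 0 \<rho> \<Longrightarrow> (\<lambda>n. z ^ n *\<^sub>C c n) sums F z"
  shows "vholomorphic_on F (ball 0 \<rho>)"
  unfolding vholomorphic_on_def using has_cderiv_power_series[of \<rho> c F] assms by blast

text \<open>The induction leaves \<open>F\<close> and \<open>c\<close> arbitrary, because the
  derivative is again a power series on the same ball, with coefficients
  \<open>(n + 1) * c (n + 1)\<close>.\<close>

lemma power_series_maclaurin_coeff:
  fixes c :: "nat \<Rightarrow> 'a::complex_banach"
  assumes "\<And>z. z \<in> ball 0 \<rho> \<Longrightarrow> (\<lambda>n. z ^ n *\<^sub>C c n) sums F z" and "\<rho> > 0"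
  shows "maclaurin_coeff F k = c k"
proof -
  have "(cderiv ^^ k) F 0 = fact k *\<^sub>R c k"
    using assms(1)
  proof (induction k arbitrary: F c)
    case 0
    have "(\<lambda>n. 0 ^ n *\<^sub>C c n) sums c 0"
      using sums_finite[of "{0}" "\<lambda>n. 0 ^ n *\<^sub>C c n"]
      by (simp add: scaleC.zero_left power_0_left)
    then show ?case
      using 0[of 0] \<open>\<rho> > 0\<close> by (simp add: sums_unique2)
  next
    case (Suc k)
    have "(\<lambda>n. z ^ n *\<^sub>C of_nat (Suc n) *\<^sub>C c (Suc n)) sums cderiv F z" if "z \<in> ball 0 \<rho>" for z
      using has_cderiv_power_series[of \<rho> c F z] Suc.prems that has_cderiv_cderiv by blast
    from Suc.IH[of "\<lambda>n. of_nat (Suc n) *\<^sub>C c (Suc n)", OF this]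
    have "(cderiv ^^ Suc k) F 0 = fact k *\<^sub>R of_nat (Suc k) *\<^sub>C c (Suc k)"
      by (simp add: funpow_Suc_right del: funpow.simps of_nat_Suc)
    also have "(of_nat (Suc k) :: complex) = of_real (real (Suc k))" by simp
    finally show ?case
      by (simp only: scaleC_of_real scaleR_scaleR) (simp add: mult.commute)
  qed
  then show ?thesis
    by (simp add: maclaurin_coeff_def)
qed

lemma power_series_maclaurin_sums_on:
  fixes c :: "nat \<Rightarrow> 'a::complex_banach"
  assumes "\<And>z. z \<in> ball 0 \<rho> \<Longrightarrow> (\<lambda>n. z ^ n *\<^sub>C c n) sums F z"
  shows "maclaurin_sums_on F (ball 0 \<rho>)"
proof (cases "\<rho> > 0")
  case True
  then show ?thesis
    using power_series_maclaurin_coeff[of \<rho> c F] assms by (simp add: maclaurin_sums_on_def)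
next
  case False
  then have "ball (0::complex) \<rho> = {}" by simp
  then show ?thesis unfolding maclaurin_sums_on_def by blast
qed

lemma power_series_tendsto_0:
  fixes c :: "nat \<Rightarrow> 'a::complex_banach"
  assumes "\<And>z. z \<in> ball 0 \<rho> \<Longrightarrow> (\<lambda>n. z ^ n *\<^sub>C c n) sums F z" and "\<rho> > 0"
  shows "F \<midarrow>0\<rightarrow> c 0"
proof -
  have "F 0 = c 0"
    using power_series_maclaurin_coeff[OF assms, of 0] by (simp add: maclaurin_coeff_def)
  moreover obtain D where "has_cderiv F D 0"
    using has_cderiv_power_series[of \<rho> c F 0] assms by auto
  then have "isCont F 0"
    unfolding has_cderiv_def by (rule has_derivative_continuous)
  ultimately show ?thesis by (simp add: isCont_def)
qed

section \<open>Uniqueness of Laurent coefficients by integration over circles\<close>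

lemma integral_cis_of_int:
  "integral {0..2 * pi} (\<lambda>t. cis (of_int k * t)) = (if k = 0 then 2 * pi else 0)"
proof (cases "k = 0")
  case False
  have "((\<lambda>t. cis (of_int k * t)) has_integral
      cis (of_int k * (2 * pi)) / (\<i> * of_int k) - cis (of_int k * 0) / (\<i> * of_int k)) {0..2 * pi}"
  proof (rule fundamental_theorem_of_calculus)
    fix t :: real
    have "((\<lambda>z. exp (\<i> * of_int k * z) / (\<i> * of_int k)) has_field_derivative
        exp (\<i> * of_int k * of_real t)) (at (of_real t))"
      using False by (auto intro!: derivative_eq_intros)
    from has_vector_derivative_real_field[OF this]
    show "((\<lambda>t. cis (of_int k * t) / (\<i> * of_int k)) has_vector_derivative cis (of_int k * t))
        (at t within {0..2 * pi})"
      by (simp add: cis_conv_exp mult.assoc)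
  qed simp
  moreover have "cis (of_int k * (2 * pi)) = 1"
    using cis_multiple_2pi[of "of_int k"] by (simp add: mult_ac)
  ultimately show ?thesis
    using False by (simp add: integral_unique)
qed (simp add: scaleR_conv_of_real)

lemma integral_scaleC_left:
  fixes c :: "'a::complex_banach"
  assumes "continuous_on {a..b::real} f"
  shows "integral {a..b} (\<lambda>t. f t *\<^sub>C c) = integral {a..b} f *\<^sub>C c"
  using integral_linear[OF integrable_continuous_interval[OF assms] scaleC.bounded_linear_left]
  by (simp add: o_def)

lemma integral_cis_scaleC:
  fixes x :: "'a::complex_banach"
  shows "integral {0..2 * pi} (\<lambda>t. (a * cis (of_int k * t)) *\<^sub>C x) =
    (if k = 0 then (a * of_real (2 * pi)) *\<^sub>C x else 0)"
proof -
  have "integral {0..2 * pi} (\<lambda>t. (a * cis (of_int k * t)) *\<^sub>C x) =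
      (a * integral {0..2 * pi} (\<lambda>t. cis (of_int k * t))) *\<^sub>C x"
    by (subst integral_scaleC_left) (auto intro!: continuous_intros)
  then show ?thesis
    unfolding integral_cis_of_int by (auto simp: scaleC.zero_left)
qed

lemma integral_series_zero:
  fixes f :: "nat \<Rightarrow> real \<Rightarrow> 'a::banach"
  assumes "\<And>n. continuous_on {a..b} (f n)" "\<And>n t. t \<in> {a..b} \<Longrightarrow> norm (f n t) \<le> M n" "summable M"
    and "\<And>t. t \<in> {a..b} \<Longrightarrow> (\<lambda>n. f n t) sums 0"
  shows "(\<lambda>n. integral {a..b} (f n)) sums 0"
proof -
  have "uniform_limit (cbox a b) (\<lambda>n t. \<Sum>i<n. f i t) (\<lambda>t. \<Sum>i. f i t) sequentially"
    using assms by (intro Weierstrass_m_test) auto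
  then obtain I J where IJ: "\<And>n. ((\<lambda>t. \<Sum>i<n. f i t) has_integral I n) (cbox a b)"
      "((\<lambda>t. \<Sum>i. f i t) has_integral J) (cbox a b)" "I \<longlonglongrightarrow> J"
    by (rule uniform_limit_integral_cbox) (use assms(1) in \<open>auto intro!: continuous_intros\<close>)
  have "((\<lambda>t. \<Sum>i. f i t) has_integral 0) (cbox a b)"
    by (rule has_integral_is_0) (use sums_unique[OF assms(4)] in auto)
  then have "J = 0" using IJ(2) has_integral_unique by blast
  moreover have "I n = (\<Sum>i<n. integral {a..b} (f i))" for n
    using integral_unique[OF IJ(1)[of n]] assms(1)
    by (simp add: integral_sum integrable_continuous_interval)
  ultimately show ?thesis
    using IJ(3) unfolding sums_def by presburger
qed

lemma has_laurent_series_iff: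
  "has_laurent_series F a z0 \<longleftrightarrow> (\<exists>r>0. \<forall>w. 0 < cmod w \<and> cmod w < r \<longrightarrow>
    (\<exists>R S. (\<lambda>n. w ^ n *\<^sub>C a (int n)) sums R \<and>
      (\<lambda>n. inverse w ^ Suc n *\<^sub>C a (- int (Suc n))) sums S \<and> F (z0 + w) = R + S))"
proof -
  have shift: "(\<forall>z. Q (z - z0) z) \<longleftrightarrow> (\<forall>w. Q w (z0 + w))" for Q :: "complex \<Rightarrow> complex \<Rightarrow> bool"
    by (metis add_diff_cancel_left' add_diff_eq add.commute diff_add_cancel)
  show ?thesis
    unfolding has_laurent_series_def dist_norm
    by (subst shift) (rule refl)
qed

text \<open>Multiply the vanishing series by \<open>cis (- m * t)\<close> and integrate over the
  circle of radius \<open>s\<close>: by orthogonality only a positive multiple of \<open>c m\<close>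
  survives.\<close>

lemma has_laurent_series_zero:
  fixes c :: "int \<Rightarrow> 'a::complex_banach"
  assumes "has_laurent_series (\<lambda>_. 0) c z0"
  shows "c m = 0"
proof -
  obtain r where r: "r > 0" and ser: "\<forall>w. 0 < cmod w \<and> cmod w < r \<longrightarrow>
      (\<exists>R S. (\<lambda>n. w ^ n *\<^sub>C c (int n)) sums R \<and>
        (\<lambda>n. inverse w ^ Suc n *\<^sub>C c (- int (Suc n))) sums S \<and> 0 = R + S)"
    using assms unfolding has_laurent_series_iff by (elim exE conjE)
  define s where "s = r / 2"
  have s: "s > 0" using r by (simp add: s_def)
  \<comment> \<open>The point \<open>3 / 4 * r\<close> lies between \<open>s\<close> and
    \<open>r\<close>, so the regular part converges absolutely on the circle of radius
    \<open>s\<close>.\<close>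
  have reg: "summable (\<lambda>n. norm (c (int n)) * s ^ n)"
    using ser[rule_format, of "of_real (3 / 4 * r)"] r
    by (intro sums_scaleC_norm_summable[where z = "of_real (3 / 4 * r)"])
      (auto simp: s_def norm_mult intro: sums_summable)
  \<comment> \<open>At \<open>r / 4\<close> the inverse is \<open>4 / r\<close>, which exceeds
    \<open>inverse s = 2 / r\<close>. One factor \<open>4 / r\<close> goes into the coefficient,
    because the exponents here are \<open>Suc n\<close> instead of \<open>n\<close>; the
    multiplication that follows undoes this.\<close>
  have "summable (\<lambda>n. norm (of_real (4 / r) *\<^sub>C c (- int (Suc n))) * inverse s ^ n)"
  proof (rule sums_scaleC_norm_summable[where z = "of_real (4 / r)"])
    have "inverse (of_real (r / 4)) = (of_real (4 / r) :: complex)"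
      using r by (simp add: field_simps)
    then show "summable (\<lambda>n. of_real (4 / r) ^ n *\<^sub>C complex_of_real (4 / r) *\<^sub>C c (- int (Suc n)))"
      using ser[rule_format, of "of_real (r / 4)"] r
      by (auto simp: scaleC_scaleC mult.commute simp del: of_real_divide intro: sums_summable)
  qed (use r in \<open>auto simp: s_def norm_divide field_simps\<close>)
  then have "summable (\<lambda>n. (r / 4 * inverse s) * (norm (of_real (4 / r) *\<^sub>C c (- int (Suc n))) * inverse s ^ n))"
    by (rule summable_mult)
  then have prin: "summable (\<lambda>n. norm (c (- int (Suc n))) * inverse s ^ Suc n)"
    using r by (simp add: norm_scaleC norm_divide mult_ac)
  \<comment> \<open>The n-th regular and the n-th principal term are paired into one series, so that
    a single termwise integration treats both parts.\<close>
  define f where "f n t = cis (- of_int m * t) *\<^sub>C ((of_real s * cis t) ^ n *\<^sub>C c (int n) +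
      inverse (of_real s * cis t) ^ Suc n *\<^sub>C c (- int (Suc n)))" for n t
  have f: "f n t = (of_real (s ^ n) * cis (of_int (int n - m) * t)) *\<^sub>C c (int n) +
      (of_real (inverse s ^ Suc n) * cis (of_int (- int (Suc n) - m) * t)) *\<^sub>C c (- int (Suc n))" for n t
  proof -
    have "cis (- of_int m * t) * (of_real s * cis t) ^ n = of_real (s ^ n) * cis (of_int (int n - m) * t)"
      by (simp add: power_mult_distrib Complex.DeMoivre cis_mult algebra_simps)
    moreover have "inverse (cis t) ^ Suc n = cis (real (Suc n) * - t)"
      by (simp only: cis_inverse Complex.DeMoivre)
    then have "cis (- of_int m * t) * inverse (of_real s * cis t) ^ Suc n =
        of_real (inverse s ^ Suc n) * cis (of_int (- int (Suc n) - m) * t)"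
      by (simp add: power_mult_distrib cis_mult algebra_simps del: power_Suc cis_inverse)
    ultimately show ?thesis
      by (simp only: f_def scaleC_add_right scaleC_scaleC)
  qed
  have cont_scaleC: "continuous_on {0..2 * pi} (\<lambda>t. g t *\<^sub>C x)" if "continuous_on {0..2 * pi} g"
    for g :: "real \<Rightarrow> complex" and x :: 'a
    using that by (rule bounded_linear.continuous_on[OF scaleC.bounded_linear_left])
  have "(\<lambda>n. integral {0..2 * pi} (f n)) sums 0"
  proof (rule integral_series_zero)
    show "continuous_on {0..2 * pi} (f n)" for n
      unfolding f by (intro continuous_intros cont_scaleC)
    show "summable (\<lambda>n. norm (c (int n)) * s ^ n + norm (c (- int (Suc n))) * inverse s ^ Suc n)"
      by (intro summable_add reg prin)
    show "norm (f n t) \<le> norm (c (int n)) * s ^ n + norm (c (- int (Suc n))) * inverse s ^ Suc n" for n t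
      unfolding f by (rule norm_triangle_le)
        (use s in \<open>simp add: norm_scaleC norm_mult norm_power norm_inverse\<close>)
    show "(\<lambda>n. f n t) sums 0" for t
    proof -
      have "0 < cmod (of_real s * cis t)" "cmod (of_real s * cis t) < r"
        using s r by (simp_all add: norm_mult s_def)
      from ser[rule_format, OF conjI, OF this] obtain R S where "(\<lambda>n. (of_real s * cis t) ^ n *\<^sub>C c (int n)) sums R"
        "(\<lambda>n. inverse (of_real s * cis t) ^ Suc n *\<^sub>C c (- int (Suc n))) sums S" "0 = R + S"
        by blast
      from bounded_linear.sums[OF scaleC.bounded_linear_right sums_add[OF this(1,2)], of "cis (- of_int m * t)"]
      show ?thesis
        unfolding f_def \<open>0 = R + S\<close>[symmetric] scaleC.zero_right .
    qed
  qed
  moreover have int_f: "integral {0..2 * pi} (f n) =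
      (if int n = m then of_real (s ^ n * (2 * pi)) *\<^sub>C c m else 0) +
      (if - int (Suc n) = m then of_real (inverse s ^ Suc n * (2 * pi)) *\<^sub>C c m else 0)" for n
    unfolding f
  proof (subst integral_add)
    show "(\<lambda>t. (of_real (s ^ n) * cis (of_int (int n - m) * t)) *\<^sub>C c (int n))
        integrable_on {0..2 * pi}"
      "(\<lambda>t. (of_real (inverse s ^ Suc n) * cis (of_int (- int (Suc n) - m) * t)) *\<^sub>C c (- int (Suc n)))
        integrable_on {0..2 * pi}"
      by (intro integrable_continuous_interval cont_scaleC continuous_intros)+
  qed (auto simp: integral_cis_scaleC simp del: of_int_diff of_nat_Suc)
  \<comment> \<open>\<open>k\<close> is the one index whose pair contains the coefficient at
    \<open>m\<close>: either \<open>m = k\<close> or \<open>m = - (k + 1)\<close>.\<close>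
  define k where "k = (if m \<ge> 0 then nat m else nat (- m - 1))"
  have "(\<lambda>n. integral {0..2 * pi} (f n)) sums (\<Sum>n\<in>{k}. integral {0..2 * pi} (f n))"
    by (rule sums_finite) (auto simp: int_f k_def)
  ultimately have "integral {0..2 * pi} (f k) = 0"
    using sums_unique2 by fastforce
  then have "(if m \<ge> 0 then s ^ nat m * (2 * pi) else inverse s ^ Suc (nat (- m - 1)) * (2 * pi)) *\<^sub>R c m = 0"
    by (cases "m \<ge> 0")
      (simp_all add: int_f k_def scaleC_of_real del: of_real_mult of_real_power power_Suc)
  then show ?thesis
    using s by (simp split: if_splits)
qed

text \<open>Needed twice: to carry the vanishing coefficients of a simple pole over to
  \<open>N\<close>, and to read \<open>N\<close> off an explicit expansion.\<close>

lemma has_laurent_series_unique: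
  fixes a b :: "int \<Rightarrow> 'a::complex_banach"
  assumes "has_laurent_series F a z0" "has_laurent_series F b z0"
  shows "a = b"
proof
  fix m
  obtain r where r: "r > 0" "\<forall>w. 0 < cmod w \<and> cmod w < r \<longrightarrow>
      (\<exists>R S. (\<lambda>n. w ^ n *\<^sub>C a (int n)) sums R \<and>
        (\<lambda>n. inverse w ^ Suc n *\<^sub>C a (- int (Suc n))) sums S \<and> F (z0 + w) = R + S)"
    using assms(1) unfolding has_laurent_series_iff by (elim exE conjE)
  obtain r' where r': "r' > 0" "\<forall>w. 0 < cmod w \<and> cmod w < r' \<longrightarrow>
      (\<exists>R S. (\<lambda>n. w ^ n *\<^sub>C b (int n)) sums R \<and>
        (\<lambda>n. inverse w ^ Suc n *\<^sub>C b (- int (Suc n))) sums S \<and> F (z0 + w) = R + S)"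
    using assms(2) unfolding has_laurent_series_iff by (elim exE conjE)
  have "has_laurent_series (\<lambda>_. 0) (\<lambda>j. a j - b j) z0"
    unfolding has_laurent_series_iff
  proof (intro exI[of _ "min r r'"] conjI allI impI)
    fix w assume w: "0 < cmod w \<and> cmod w < min r r'"
    obtain R S where RS: "(\<lambda>n. w ^ n *\<^sub>C a (int n)) sums R"
        "(\<lambda>n. inverse w ^ Suc n *\<^sub>C a (- int (Suc n))) sums S" "F (z0 + w) = R + S"
      using r(2)[rule_format, of w] w by auto
    obtain R' S' where RS': "(\<lambda>n. w ^ n *\<^sub>C b (int n)) sums R'"
        "(\<lambda>n. inverse w ^ Suc n *\<^sub>C b (- int (Suc n))) sums S'" "F (z0 + w) = R' + S'"
      using r'(2)[rule_format, of w] w by auto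
    have "0 = (R - R') + (S - S')"
      using RS(3) RS'(3) by (simp add: algebra_simps)
    then show "\<exists>R S. (\<lambda>n. w ^ n *\<^sub>C (a (int n) - b (int n))) sums R \<and>
        (\<lambda>n. inverse w ^ Suc n *\<^sub>C (a (- int (Suc n)) - b (- int (Suc n)))) sums S \<and> 0 = R + S"
      unfolding scaleC.diff_right
      by (intro exI[of _ "R - R'"] exI[of _ "S - S'"] conjI sums_diff RS RS')
  qed (use r r' in simp)
  then show "a m = b m"
    using has_laurent_series_zero by fastforce
qed

section \<open>Resolvent power series\<close>

primrec op_power :: "('a::real_normed_vector \<Rightarrow>\<^sub>L 'a) \<Rightarrow> nat \<Rightarrow> ('a \<Rightarrow>\<^sub>L 'a)" where
  "op_power A 0 = id_blinfun"
| "op_power A (Suc n) = A o\<^sub>L op_power A n"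

lemma inverse_op_composeD:
  "inverse_op A B \<Longrightarrow> A o\<^sub>L B = id_blinfun" "inverse_op A B \<Longrightarrow> B o\<^sub>L A = id_blinfun"
  "inverse_op A B \<Longrightarrow> clinear_op B"
  by (simp_all add: inverse_op_def)

text \<open>Once an inverse is known to exist, a formula for it has to be verified on one side
  only.\<close>

lemma right_inverse_unique:
  assumes "inverse_op A B" "A o\<^sub>L C = id_blinfun"
  shows "C = B"
proof -
  have "C = (B o\<^sub>L A) o\<^sub>L C" using assms by (simp add: inverse_op_def)
  also have "\<dots> = B" unfolding compose_assoc assms(2) by simp
  finally show ?thesis .
qed

text \<open>Multiplication by \<open>z *\<^sub>C S\<close> shifts the series by one index, so its
  sum \<open>Q\<close> satisfies \<open>Q = I + z S Q\<close> and is a right inverse.\<close>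

lemma neumann_series:
  fixes S :: "'a::complex_banach \<Rightarrow>\<^sub>L 'a"
  assumes clin: "clinear_op S" and inv: "inverse_op (id_blinfun - z *\<^sub>C S) R"
    and summ: "summable (\<lambda>k. norm (op_power S k) * cmod z ^ k)"
  shows "(\<lambda>k. z ^ k *\<^sub>C op_power S k) sums R"
proof -
  have "summable (\<lambda>k. z ^ k *\<^sub>C op_power S k)"
    by (rule summable_norm_cancel)
      (use summ in \<open>simp add: norm_scaleC norm_power mult.commute\<close>)
  then obtain Q where Q: "(\<lambda>k. z ^ k *\<^sub>C op_power S k) sums Q"
    unfolding summable_def by blast
  have "(\<lambda>k. z *\<^sub>C (S o\<^sub>L (z ^ k *\<^sub>C op_power S k))) sums (z *\<^sub>C (S o\<^sub>L Q))"
    by (intro bounded_linear.sums[OF scaleC.bounded_linear_right]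
        bounded_linear.sums[OF compose.bounded_linear_right] Q)
  then have "(\<lambda>k. z ^ Suc k *\<^sub>C op_power S (Suc k)) sums (z *\<^sub>C (S o\<^sub>L Q))"
    by (simp add: compose_scaleC[OF clin] scaleC_scaleC)
  then have "(\<lambda>k. z ^ k *\<^sub>C op_power S k) sums (z *\<^sub>C (S o\<^sub>L Q) + id_blinfun)"
    using sums_Suc_iff[of "\<lambda>k. z ^ k *\<^sub>C op_power S k"] by simp
  then have "Q = z *\<^sub>C (S o\<^sub>L Q) + id_blinfun"
    using Q sums_unique2 by blast
  then have "(id_blinfun - z *\<^sub>C S) o\<^sub>L Q = id_blinfun"
    by (simp add: compose.diff_left scaleC_compose diff_eq_eq add.commute)
  then show ?thesis
    using right_inverse_unique[OF inv] Q by blast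
qed

lemma op_norm_compose3: "norm (A o\<^sub>L B o\<^sub>L C) \<le> norm A * norm B * norm C"
  by (rule order_trans[OF norm_blinfun_compose]) (intro mult_right_mono norm_blinfun_compose norm_ge_zero)

text \<open>The radius \<open>\<rho>\<close> is not tied to \<open>norm S\<close>; invertibility at
  each point of the disc is all that is known. The locale is interpreted for the deflated operator
  around 0 and for its shift to the centre 1.\<close>

locale disc_resolvent =
  fixes S :: "'a::complex_banach \<Rightarrow>\<^sub>L 'a" and R :: "complex \<Rightarrow> ('a \<Rightarrow>\<^sub>L 'a)" and \<rho> :: real
  assumes clinear_S: "clinear_op S"
    and inverse_resolvent: "z \<in> ball 0 \<rho> \<Longrightarrow> inverse_op (id_blinfun - z *\<^sub>C S) (R z)"
begin

lemma resolvent_eq: "z \<in> ball 0 \<rho> \<Longrightarrow> R z = id_blinfun + z *\<^sub>C (S o\<^sub>L R z)"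
  using inverse_op_composeD(1)[OF inverse_resolvent[of z]]
  by (simp add: compose.diff_left scaleC_compose diff_eq_eq add.commute)

text \<open>Resolvent identity: placed between \<open>R z\<close> and \<open>R w\<close>, the
  operator \<open>I - w S\<close> cancels \<open>R w\<close> and \<open>I - z S\<close> cancels
  \<open>R z\<close>; subtract.\<close>

lemma resolvent_diff:
  assumes "z \<in> ball 0 \<rho>" "w \<in> ball 0 \<rho>"
  shows "R z - R w = (z - w) *\<^sub>C (R z o\<^sub>L S o\<^sub>L R w)"
proof -
  have "R z o\<^sub>L (id_blinfun - w *\<^sub>C S) o\<^sub>L R w = R z"
    unfolding compose_assoc inverse_op_composeD(1)[OF inverse_resolvent[OF assms(2)]] by simp
  moreover have "R z o\<^sub>L (id_blinfun - z *\<^sub>C S) o\<^sub>L R w = R w"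
    unfolding inverse_op_composeD(2)[OF inverse_resolvent[OF assms(1)]] by simp
  ultimately have "R z - R w = R z o\<^sub>L ((id_blinfun - w *\<^sub>C S) - (id_blinfun - z *\<^sub>C S)) o\<^sub>L R w"
    by (simp only: compose.diff_left compose.diff_right)
  also have "(id_blinfun - w *\<^sub>C S) - (id_blinfun - z *\<^sub>C S) = (z - w) *\<^sub>C S"
    by (simp add: scaleC.diff_left)
  finally show ?thesis
    by (simp add: compose_scaleC[OF inverse_op_composeD(3)[OF inverse_resolvent[OF assms(1)]]] scaleC_compose)
qed

text \<open>The resolvent identity bounds \<open>R z - R w\<close> by
  \<open>cmod (z - w) * K * norm (R z)\<close>, where \<open>norm (R z)\<close> is itself
  uncontrolled. As soon as \<open>cmod (z - w) * K < 1 / 2\<close>, absorbing this term gives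
  \<open>norm (R z) \<le> 2 * norm (R w)\<close>.\<close>

lemma resolvent_continuous:
  assumes w: "w \<in> ball 0 \<rho>"
  shows "isCont R w"
proof -
  define K where "K = norm S * norm (R w)"
  have "((\<lambda>z. cmod (z - w) * K) \<longlongrightarrow> 0) (at w)"
    by (auto intro!: tendsto_eq_intros)
  then have small: "\<forall>\<^sub>F z in at w. cmod (z - w) * K < 1 / 2"
    by (rule order_tendstoD) simp
  have ball: "\<forall>\<^sub>F z in at w. z \<in> ball 0 \<rho>"
    using w by (intro eventually_at_in_open') auto
  have "((\<lambda>z. R z - R w) \<longlongrightarrow> 0) (at w)"
  proof (rule Lim_null_comparison)
    show "\<forall>\<^sub>F z in at w. norm (R z - R w) \<le> cmod (z - w) * (2 * norm (R w) * K)"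
      using small ball
    proof eventually_elim
      case (elim z)
      have "norm (R z - R w) \<le> cmod (z - w) * (norm (R z) * norm S * norm (R w))"
        unfolding resolvent_diff[OF elim(2) w] norm_scaleC by (intro mult_left_mono op_norm_compose3) simp
      then have d: "norm (R z - R w) \<le> cmod (z - w) * K * norm (R z)"
        by (simp add: K_def mult_ac)
      also have "\<dots> \<le> 1 / 2 * norm (R z)"
        using elim(1) by (intro mult_right_mono) auto
      finally have "norm (R z) \<le> 2 * norm (R w)"
        using norm_triangle_sub[of "R z" "R w"] by simp
      then have "cmod (z - w) * K * norm (R z) \<le> cmod (z - w) * K * (2 * norm (R w))"
        by (intro mult_left_mono) (simp_all add: K_def)
      then show ?case using d by (simp add: mult_ac)
    qed
    show "((\<lambda>z. cmod (z - w) * (2 * norm (R w) * K)) \<longlongrightarrow> 0) (at w)"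
      by (auto intro!: tendsto_eq_intros)
  qed
  then show ?thesis
    by (simp add: isCont_def LIM_zero_cancel)
qed

text \<open>By the resolvent identity the error quotient has exactly the norm of
  \<open>(R z - R w) S (R w)\<close>, so continuity of \<open>R\<close> suffices.\<close>

lemma resolvent_has_derivative:
  assumes w: "w \<in> ball 0 \<rho>"
  shows "(R has_derivative (\<lambda>h. h *\<^sub>C (R w o\<^sub>L S o\<^sub>L R w))) (at w)"
  unfolding has_derivative_iff_norm
proof (intro conjI bounded_linear_intros scaleC.bounded_linear_left)
  have ball: "\<forall>\<^sub>F z in at w. z \<in> ball 0 \<rho>"
    using w by (intro eventually_at_in_open') auto
  have "\<forall>\<^sub>F z in at w. norm (R z - R w - (z - w) *\<^sub>C (R w o\<^sub>L S o\<^sub>L R w)) / norm (z - w) =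
      norm ((R z - R w) o\<^sub>L S o\<^sub>L R w)"
    using ball eventually_neq_at_within[of w]
  proof eventually_elim
    case (elim z)
    have "R z - R w - (z - w) *\<^sub>C (R w o\<^sub>L S o\<^sub>L R w) = (z - w) *\<^sub>C ((R z - R w) o\<^sub>L S o\<^sub>L R w)"
      by (subst resolvent_diff[OF elim(1) w]) (simp add: compose.diff_left scaleC.diff_right)
    then show ?case using elim(2) by (simp add: norm_scaleC)
  qed
  moreover have "((\<lambda>z. norm ((R z - R w) o\<^sub>L S o\<^sub>L R w)) \<longlongrightarrow> 0) (at w)"
    using resolvent_continuous[OF w] unfolding isCont_def
    by (auto intro!: tendsto_eq_intros compose.tendsto)
  ultimately show "((\<lambda>z. norm (R z - R w - (z - w) *\<^sub>C (R w o\<^sub>L S o\<^sub>L R w)) / norm (z - w)) \<longlongrightarrow> 0) (at w)"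
    by (simp add: tendsto_cong)
qed

lemma continuous_on_resolvent_comp:
  assumes "continuous_on A f" "f ` A \<subseteq> ball 0 \<rho>"
  shows "continuous_on A (\<lambda>x. R (f x))"
proof -
  have "continuous_on (ball 0 \<rho>) R"
    by (intro continuous_at_imp_continuous_on ballI resolvent_continuous)
  then show ?thesis
    using continuous_on_compose2 assms by blast
qed

text \<open>The integral does not depend on the radius: its radial derivative integrates
  \<open>cis t *\<^sub>C R'\<close>, which up to the factor \<open>\<i> * x\<close> is the angular
  derivative of a periodic function. At radius 0 the integrand is the identity.\<close>

lemma resolvent_mean_value:
  assumes "0 \<le> s" "s < \<rho>"
  shows "integral {0..2 * pi} (\<lambda>t. R (of_real s * cis t)) = (2 * pi) *\<^sub>R id_blinfun"
proof -
  define R' where "R' z = R z o\<^sub>L S o\<^sub>L R z" for z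
  have in_ball: "of_real x * cis t \<in> ball 0 \<rho>" if "x \<in> {0..s}" for x t
    using that assms by (simp add: norm_mult)
  have cont_R': "continuous_on A (\<lambda>p. R' (of_real (f p) * cis (g p)))"
    if "continuous_on A f" "continuous_on A g" "f ` A \<subseteq> {0..s}"
    for f g and A :: "'c::topological_space set"
    unfolding R'_def using that in_ball
    by (intro compose.continuous_on continuous_on_const continuous_on_resolvent_comp continuous_intros) auto
  have deriv: "((\<lambda>x. integral (cbox 0 (2 * pi)) (\<lambda>t. R (of_real x * cis t))) has_vector_derivative
      integral (cbox 0 (2 * pi)) (\<lambda>t. cis t *\<^sub>C R' (of_real x * cis t))) (at x within {0..s})"
    if "x \<in> {0..s}" for x
  proof (rule leibniz_rule_vector_derivative)
    fix x t assume x: "x \<in> {0..s}"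
    have "((\<lambda>x. of_real x * cis t) has_derivative (\<lambda>h. of_real h * cis t)) (at x within {0..s})"
      by (auto intro!: derivative_eq_intros)
    from has_derivative_compose[OF this resolvent_has_derivative[OF in_ball[OF x]]]
    show "((\<lambda>x. R (of_real x * cis t)) has_vector_derivative cis t *\<^sub>C R' (of_real x * cis t))
        (at x within {0..s})"
      by (simp add: has_vector_derivative_def R'_def scaleC_of_real flip: scaleC_scaleC)
  next
    fix x assume "x \<in> {0..s}"
    then show "(\<lambda>t. R (of_real x * cis t)) integrable_on cbox 0 (2 * pi)"
      unfolding cbox_interval using in_ball
      by (intro integrable_continuous_interval continuous_on_resolvent_comp continuous_intros) auto
  next
    show "continuous_on ({0..s} \<times> cbox 0 (2 * pi)) (\<lambda>(x, t). cis t *\<^sub>C R' (of_real x * cis t))"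
      unfolding split_beta
      by (intro scaleC.continuous_on cont_R' continuous_intros) auto
  qed (use that in auto)
  \<comment> \<open>The factor \<open>\<i> * x\<close> is cancelled here, so radius 0 is excluded;
    at that one point continuity in the radius is enough below.\<close>
  have zero: "integral (cbox 0 (2 * pi)) (\<lambda>t. cis t *\<^sub>C R' (of_real x * cis t)) = 0"
    if x: "x \<in> {0..s} - {0}" for x
  proof -
    have "((\<lambda>t. (\<i> * of_real x) *\<^sub>C cis t *\<^sub>C R' (of_real x * cis t)) has_integral
        R (of_real x * cis (2 * pi)) - R (of_real x * cis 0)) {0..2 * pi}"
    proof (rule fundamental_theorem_of_calculus)
      fix t assume "t \<in> {0..2 * pi}"
      have "((\<lambda>z. of_real x * exp (\<i> * z)) has_field_derivative of_real x * (\<i> * exp (\<i> * of_real t)))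
          (at (of_real t))"
        by (auto intro!: derivative_eq_intros)
      from has_vector_derivative_real_field[OF this]
      have "((\<lambda>t. of_real x * cis t) has_derivative (\<lambda>h. h *\<^sub>R (\<i> * of_real x * cis t)))
          (at t within {0..2 * pi})"
        by (simp add: cis_conv_exp has_vector_derivative_def mult_ac)
      from has_derivative_compose[OF this resolvent_has_derivative[OF in_ball]]
      show "((\<lambda>t. R (of_real x * cis t)) has_vector_derivative
          (\<i> * of_real x) *\<^sub>C cis t *\<^sub>C R' (of_real x * cis t)) (at t within {0..2 * pi})"
        using x by (simp add: has_vector_derivative_def R'_def scaleC_scaleC scaleC.scaleR_left)
    qed simp
    then have "integral {0..2 * pi} (\<lambda>t. (\<i> * of_real x) *\<^sub>C cis t *\<^sub>C R' (of_real x * cis t)) = 0"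
      by (simp add: integral_unique)
    moreover have "(\<lambda>t. cis t *\<^sub>C R' (of_real x * cis t)) integrable_on {0..2 * pi}"
      using x by (intro integrable_continuous_interval scaleC.continuous_on cont_R' continuous_intros) auto
    then have "integral {0..2 * pi} (\<lambda>t. (\<i> * of_real x) *\<^sub>C cis t *\<^sub>C R' (of_real x * cis t)) =
        (\<i> * of_real x) *\<^sub>C integral {0..2 * pi} (\<lambda>t. cis t *\<^sub>C R' (of_real x * cis t))"
      using integral_linear[OF _ scaleC.bounded_linear_right] by (simp add: o_def)
    ultimately have "norm ((\<i> * of_real x) *\<^sub>C integral {0..2 * pi} (\<lambda>t. cis t *\<^sub>C R' (of_real x * cis t))) = 0"
      by simp
    then show ?thesis
      using x by (simp add: norm_scaleC norm_mult)
  qed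
  have "integral (cbox 0 (2 * pi)) (\<lambda>t. R (of_real s * cis t)) =
      integral (cbox 0 (2 * pi)) (\<lambda>t. R (of_real 0 * cis t))"
  proof (rule has_derivative_zero_unique_strong_interval[where k = "{0}" and a = 0 and b = s])
    show "continuous_on {0..s} (\<lambda>x. integral (cbox 0 (2 * pi)) (\<lambda>t. R (of_real x * cis t)))"
      using deriv has_vector_derivative_continuous continuous_on_eq_continuous_within by blast
    show "((\<lambda>x. integral (cbox 0 (2 * pi)) (\<lambda>t. R (of_real x * cis t))) has_derivative (\<lambda>h. 0))
        (at x within {0..s})" if "x \<in> {0..s} - {0}" for x
      using deriv[of x] zero[OF that] that by (simp add: has_vector_derivative_def)
  qed (use assms in auto)
  moreover have "R 0 = id_blinfun"
    using resolvent_eq[of 0] assms by (simp add: scaleC.zero_left)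
  ultimately show ?thesis
    by simp
qed

text \<open>The Fourier coefficients \<open>C\<close> of \<open>R\<close> on the circle of radius
  \<open>s\<close> play the part of Cauchy integrals. The equation \<open>R = I + z S R\<close>
  yields \<open>C (- (k + 1)) = s S (C (- k))\<close>, starting from the mean value. Hence
  \<open>norm (op_power S k) * s ^ k\<close> is bounded by the maximum of \<open>R\<close> on the
  circle, and the Neumann series converges inside.\<close>

theorem resolvent_power_series:
  assumes z: "z \<in> ball 0 \<rho>"
  shows "(\<lambda>k. z ^ k *\<^sub>C op_power S k) sums R z"
proof -
  obtain s where s: "cmod z < s" "s < \<rho>"
    using z dense by auto
  have s0: "0 < s" using s norm_ge_zero[of z] by linarith
  have in_ball: "of_real s * cis t \<in> ball 0 \<rho>" for t
    using s s0 by (simp add: norm_mult)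
  have cont: "continuous_on {0..2 * pi} (\<lambda>t. cis (of_int j * t) *\<^sub>C R (of_real s * cis t))" for j
    using in_ball by (intro scaleC.continuous_on continuous_on_resolvent_comp continuous_intros) auto
  define C where "C j = integral {0..2 * pi} (\<lambda>t. cis (of_int j * t) *\<^sub>C R (of_real s * cis t))" for j
  have C: "C (- int k) = (2 * pi * s ^ k) *\<^sub>R op_power S k" for k
  proof (induction k)
    case 0
    show ?case
      using resolvent_mean_value[of s] s s0 by (simp add: C_def)
  next
    case (Suc k)
    \<comment> \<open>The factor \<open>s * cis t\<close> raises the frequency from
      \<open>- (k + 1)\<close> to \<open>- k\<close>; the identity term keeps a nonzero frequency
      and integrates to 0.\<close>
    have "cis (of_int (- int (Suc k)) * t) *\<^sub>C R (of_real s * cis t) =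
        (1 * cis (of_int (- int (Suc k)) * t)) *\<^sub>C id_blinfun +
        of_real s *\<^sub>C (S o\<^sub>L (cis (of_int (- int k) * t) *\<^sub>C R (of_real s * cis t)))" for t
    proof -
      have "cis (of_int (- int (Suc k)) * t) * (of_real s * cis t) = of_real s * cis (of_int (- int k) * t)"
        by (simp add: cis_mult algebra_simps)
      then show ?thesis
        by (subst resolvent_eq[OF in_ball])
          (simp only: scaleC_add_right scaleC_scaleC compose_scaleC[OF clinear_S] mult_1_left)
    qed
    then have "C (- int (Suc k)) =
        integral {0..2 * pi} (\<lambda>t. (1 * cis (of_int (- int (Suc k)) * t)) *\<^sub>C id_blinfun +
          of_real s *\<^sub>C (S o\<^sub>L (cis (of_int (- int k) * t) *\<^sub>C R (of_real s * cis t))))"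
      by (simp only: C_def)
    also have "\<dots> = integral {0..2 * pi} (\<lambda>t. (1 * cis (of_int (- int (Suc k)) * t)) *\<^sub>C id_blinfun) +
        integral {0..2 * pi} (\<lambda>t. of_real s *\<^sub>C (S o\<^sub>L (cis (of_int (- int k) * t) *\<^sub>C R (of_real s * cis t))))"
      by (intro integral_add integrable_continuous_interval scaleC.continuous_on compose.continuous_on
          cont continuous_intros)
    also have "integral {0..2 * pi} (\<lambda>t. (1 * cis (of_int (- int (Suc k)) * t)) *\<^sub>C (id_blinfun :: 'a \<Rightarrow>\<^sub>L 'a)) = 0"
      by (subst integral_cis_scaleC) simp
    also have "integral {0..2 * pi}
          (\<lambda>t. of_real s *\<^sub>C (S o\<^sub>L (cis (of_int (- int k) * t) *\<^sub>C R (of_real s * cis t)))) =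
        of_real s *\<^sub>C (S o\<^sub>L C (- int k))"
      using integral_linear[OF integrable_continuous_interval[OF cont[of "- int k"]]
          bounded_linear_compose[OF scaleC.bounded_linear_right[of "of_real s"] compose.bounded_linear_right[of S]]]
      by (simp add: o_def C_def)
    finally show ?case
      using Suc.IH by (simp add: scaleC_of_real compose.scaleR_right mult_ac)
  qed
  have "compact ((\<lambda>t. R (of_real s * cis t)) ` {0..2 * pi})"
    using in_ball by (intro compact_continuous_image continuous_on_resolvent_comp continuous_intros) auto
  then have "bounded ((\<lambda>t. R (of_real s * cis t)) ` {0..2 * pi})"
    by (rule compact_imp_bounded)
  then obtain M where M: "\<forall>x\<in>(\<lambda>t. R (of_real s * cis t)) ` {0..2 * pi}. norm x \<le> M"
    unfolding bounded_iff by (elim exE)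
  have "norm (op_power S k) * s ^ k \<le> M" for k
  proof -
    have "norm (C (- int k)) \<le> M * (2 * pi - 0)"
      unfolding C_def by (rule integral_bound[OF _ cont]) (use M in \<open>auto simp: norm_scaleC\<close>)
    then show ?thesis
      unfolding C using s0 by (simp add: abs_mult field_simps)
  qed
  then have "summable (\<lambda>k. norm (op_power S k) * cmod z ^ k)"
    using s by (intro Abel_lemma) auto
  then show ?thesis
    using z by (intro neumann_series clinear_S inverse_resolvent)
qed

end

section \<open>Simple poles of the resolvent\<close>

text \<open>Here \<open>L\<close> and \<open>K\<close> stand for multiplication by the two coefficients of the pencil on one fixed
  side, so that a single computation yields the identities for both sides.\<close>

lemma simple_pole_coefficients:
  fixes L K :: "'a::complex_banach \<Rightarrow> 'a"
  assumes L: "bounded_linear L" "\<And>c x. L (c *\<^sub>C x) = c *\<^sub>C L x"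
    and K: "bounded_linear K" "\<And>c x. K (c *\<^sub>C x) = c *\<^sub>C K x"
    and R: "R \<midarrow>0\<rightarrow> a"
    and eq: "\<forall>\<^sub>F w in at 0. L (R w + inverse w *\<^sub>C b) - w *\<^sub>C K (R w + inverse w *\<^sub>C b) = e"
  shows "L b = 0" "L a - K b = e"
proof -
  have w_0: "((\<lambda>w. w *\<^sub>C f w) \<longlongrightarrow> 0) (at 0)" if "(f \<longlongrightarrow> y) (at 0)" for f :: "complex \<Rightarrow> 'a" and y
    using scaleC.tendsto[OF tendsto_ident_at that] by (simp add: scaleC.zero_left)
  have LR: "((\<lambda>w. L (R w)) \<longlongrightarrow> L a) (at 0)" and KR: "((\<lambda>w. K (R w)) \<longlongrightarrow> K a) (at 0)"
    using bounded_linear.tendsto[OF L(1) R] bounded_linear.tendsto[OF K(1) R] .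
  have lim: "((\<lambda>w. e - (L (R w) - w *\<^sub>C K (R w) - K b)) \<longlongrightarrow> e - (L a - 0 - K b)) (at 0)"
    by (intro tendsto_diff tendsto_const LR w_0[OF KR])
  \<comment> \<open>The singular term is isolated on the left, while the right side converges.
    Multiplying by \<open>w\<close> therefore forces \<open>L b = 0\<close>; then the right side is
    0 near 0, and its limit is the second identity.\<close>
  have Lb: "\<forall>\<^sub>F w in at 0. inverse w *\<^sub>C L b = e - (L (R w) - w *\<^sub>C K (R w) - K b)"
    using eq eventually_neq_at_within[of 0]
  proof eventually_elim
    case (elim w)
    then show ?case
      by (simp add: linear_add[OF bounded_linear.linear[OF L(1)]]
          linear_add[OF bounded_linear.linear[OF K(1)]] L(2) K(2) scaleC_add_right scaleC_scaleC
          algebra_simps)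
  qed
  have const: "\<forall>\<^sub>F w in at 0. w *\<^sub>C (e - (L (R w) - w *\<^sub>C K (R w) - K b)) = L b"
    using Lb eventually_neq_at_within[of 0]
  proof eventually_elim
    case (elim w)
    show ?case
      unfolding elim(1)[symmetric] using elim(2) by (simp add: scaleC_scaleC)
  qed
  then show "L b = 0"
    using tendsto_unique[OF at_neq_bot w_0[OF lim] tendsto_eventually[OF const]] by simp
  then have const': "\<forall>\<^sub>F w in at 0. e - (L (R w) - w *\<^sub>C K (R w) - K b) = 0"
    using Lb by (auto elim!: eventually_mono simp: scaleC.zero_right)
  have "e - (L a - 0 - K b) = 0"
    by (rule tendsto_unique[OF at_neq_bot lim tendsto_eventually[OF const']])
  then show "L a - K b = e" by simp
qed

text \<open>The equivalence is a statement about pencils \<open>I - z T\<close>; the block structure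
  of the companion operator stays out of it.\<close>

locale unit_disc_pencil =
  fixes T :: "'a::complex_banach \<Rightarrow>\<^sub>L 'a" and \<rho> :: real and N :: "int \<Rightarrow> ('a \<Rightarrow>\<^sub>L 'a)"
    and A :: "complex \<Rightarrow> ('a \<Rightarrow>\<^sub>L 'a)"
  assumes clinear_T: "clinear_op T" and clinear_N: "\<And>j. clinear_op (N j)"
    and \<rho>: "\<rho> > 1"
    and A: "A z = id_blinfun - z *\<^sub>C T"
    and invertible: "z \<in> ball 0 \<rho> - {1} \<Longrightarrow> invertible_op (A z)"
    and not_invertible: "\<not> invertible_op (A 1)"
    and laurent: "has_laurent_series (\<lambda>z. op_inv (A z)) (\<lambda>j. - N j) 1"
begin

lemma A1: "A 1 = id_blinfun - T"
  by (simp add: A)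

lemma clinear_A: "clinear_op (A z)"
  unfolding A by (intro clinear_op_diff clinear_op_id clinear_op_scaleC clinear_T)

lemma A_shift: "A (1 + w) = A 1 - w *\<^sub>C T"
  by (simp add: A scaleC_add_left)

lemma near_1: "w \<noteq> 0 \<Longrightarrow> cmod w < \<rho> - 1 \<Longrightarrow> 1 + w \<in> ball 0 \<rho> - {1}"
  using norm_triangle_ineq[of 1 w] by simp

text \<open>Vanishing of \<open>A 1 N\<close> and \<open>N A 1\<close> for \<open>N = N (-1)\<close>
  means \<open>T N = N = N T\<close>, so \<open>P\<close> equals \<open>N\<close>. The constant
  terms then read \<open>A 1 (a 0) + P = I = (a 0) (A 1) + P\<close>: the first puts the kernel of
  \<open>P\<close> into the range of \<open>A 1\<close>, the second makes \<open>P\<close> fix the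
  kernel of \<open>A 1\<close>.\<close>

lemma simple_pole_imp_projection:
  assumes "has_simple_pole (\<lambda>z. op_inv (A z)) 1"
  shows "projection_onto_along (N (-1) o\<^sub>L T) (ker_op (A 1)) (ran_op (A 1))"
proof -
  obtain a where a: "has_laurent_series (\<lambda>z. op_inv (A z)) a 1" "\<And>j. j < - 1 \<Longrightarrow> a j = 0"
    using assms unfolding has_pole_of_order_def by auto
  then have N: "a j = - N j" for j
    using has_laurent_series_unique[OF a(1) laurent] by simp
  obtain r where r: "r > 0" "\<forall>w. 0 < cmod w \<and> cmod w < r \<longrightarrow>
      (\<exists>R S. (\<lambda>n. w ^ n *\<^sub>C a (int n)) sums R \<and>
        (\<lambda>n. inverse w ^ Suc n *\<^sub>C a (- int (Suc n))) sums S \<and> op_inv (A (1 + w)) = R + S)"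
    using a(1) unfolding has_laurent_series_iff by (elim exE conjE)
  \<comment> \<open>The Laurent expansion says nothing at \<open>w = 0\<close>; there the series has
    at most one nonzero term, which lets \<open>Q\<close> be a power series on the full
    ball.\<close>
  define Q where "Q w = (\<Sum>n. w ^ n *\<^sub>C a (int n))" for w
  have Q: "(\<lambda>n. w ^ n *\<^sub>C a (int n)) sums Q w" if w: "w \<in> ball 0 r" for w
  proof (cases "w = 0")
    case True
    have "summable (\<lambda>n. w ^ n *\<^sub>C a (int n))"
      by (rule summable_finite[of "{0}"]) (auto simp: True power_0_left scaleC.zero_left)
    then show ?thesis by (simp add: Q_def summable_sums)
  next
    case False
    then obtain R where "(\<lambda>n. w ^ n *\<^sub>C a (int n)) sums R"
      using r(2)[rule_format, of w] w by auto
    then show ?thesis by (simp add: Q_def sums_iff)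
  qed
  have F: "op_inv (A (1 + w)) = Q w + inverse w *\<^sub>C a (-1)" if w: "w \<noteq> 0" "cmod w < r" for w
  proof -
    obtain R S where RS: "(\<lambda>n. w ^ n *\<^sub>C a (int n)) sums R"
        "(\<lambda>n. inverse w ^ Suc n *\<^sub>C a (- int (Suc n))) sums S" "op_inv (A (1 + w)) = R + S"
      using r(2)[rule_format, of w] w by auto
    have "(\<lambda>n. inverse w ^ Suc n *\<^sub>C a (- int (Suc n))) sums
        (\<Sum>n\<in>{0}. inverse w ^ Suc n *\<^sub>C a (- int (Suc n)))"
      by (rule sums_finite) (auto simp: a(2) scaleC.zero_right)
    then have "S = inverse w *\<^sub>C a (-1)"
      using RS(2) sums_unique2 by fastforce
    moreover have "R = Q w"
      using RS(1) by (simp add: Q_def sums_iff)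
    ultimately show ?thesis using RS(3) by simp
  qed
  have lim: "Q \<midarrow>0\<rightarrow> a 0"
    using power_series_tendsto_0[of r "\<lambda>n. a (int n)" Q, OF Q r(1)] by simp
  have near: "\<forall>\<^sub>F w in at 0. w \<noteq> 0 \<and> cmod w < r \<and> cmod w < \<rho> - 1"
    unfolding eventually_at using r(1) \<rho> by (intro exI[of _ "min r (\<rho> - 1)"]) auto
  have "\<forall>\<^sub>F w in at 0. (A 1 o\<^sub>L (Q w + inverse w *\<^sub>C a (-1))) -
      w *\<^sub>C (T o\<^sub>L (Q w + inverse w *\<^sub>C a (-1))) = id_blinfun"
    using near
  proof eventually_elim
    case (elim w)
    then have "inverse_op (A (1 + w)) (op_inv (A (1 + w)))"
      by (intro inverse_op_op_inv invertible near_1) auto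
    moreover have "op_inv (A (1 + w)) = Q w + inverse w *\<^sub>C a (-1)"
      using elim by (intro F) auto
    ultimately have "A (1 + w) o\<^sub>L (Q w + inverse w *\<^sub>C a (-1)) = id_blinfun"
      by (simp only: inverse_op_def)
    then show ?case
      by (simp add: A_shift compose.diff_left scaleC_compose)
  qed
  from simple_pole_coefficients[OF compose.bounded_linear_right compose_scaleC[OF clinear_A]
      compose.bounded_linear_right compose_scaleC[OF clinear_T] lim this]
  have right: "A 1 o\<^sub>L a (-1) = 0" "(A 1 o\<^sub>L a 0) - (T o\<^sub>L a (-1)) = id_blinfun" by blast+
  have "\<forall>\<^sub>F w in at 0. ((Q w + inverse w *\<^sub>C a (-1)) o\<^sub>L A 1) -
      w *\<^sub>C ((Q w + inverse w *\<^sub>C a (-1)) o\<^sub>L T) = id_blinfun"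
    using near
  proof eventually_elim
    case (elim w)
    then have "inverse_op (A (1 + w)) (op_inv (A (1 + w)))"
      by (intro inverse_op_op_inv invertible near_1) auto
    moreover have "op_inv (A (1 + w)) = Q w + inverse w *\<^sub>C a (-1)"
      using elim by (intro F) auto
    \<comment> \<open>Linearity of the inverse is recorded because the scalar \<open>w\<close> has
      to be pulled out from behind it.\<close>
    ultimately have "clinear_op (Q w + inverse w *\<^sub>C a (-1))"
      "(Q w + inverse w *\<^sub>C a (-1)) o\<^sub>L A (1 + w) = id_blinfun"
      by (simp_all only: inverse_op_def)
    then show ?case
      by (simp add: A_shift compose.diff_right compose_scaleC)
  qed
  from simple_pole_coefficients[OF compose.bounded_linear_left scaleC_compose
      compose.bounded_linear_left scaleC_compose lim this]
  have left: "a (-1) o\<^sub>L A 1 = 0" "(a 0 o\<^sub>L A 1) - (a (-1) o\<^sub>L T) = id_blinfun" by blast+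
  define P where "P = N (-1) o\<^sub>L T"
  have "N (-1) o\<^sub>L A 1 = 0"
    using left(1) by (simp add: N compose.minus_left)
  then have P: "P = N (-1)"
    by (simp add: P_def A1 compose.diff_right)
  have "A 1 o\<^sub>L N (-1) = 0"
    using right(1) by (simp add: N compose.minus_right)
  then have TN: "T o\<^sub>L N (-1) = N (-1)"
    by (simp add: A1 compose.diff_left)
  have AP: "A 1 (P x) = 0" and PA: "P (A 1 x) = 0" for x
    using \<open>A 1 o\<^sub>L N (-1) = 0\<close> \<open>N (-1) o\<^sub>L A 1 = 0\<close>
    by (simp_all add: P flip: blinfun_apply_blinfun_compose)
  have "(A 1 o\<^sub>L a 0) + P = id_blinfun" "(a 0 o\<^sub>L A 1) + P = id_blinfun"
    using left(2) right(2) P by (simp_all add: N compose.minus_left compose.minus_right TN P_def)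
  then have Px: "A 1 (a 0 x) + P x = x" "a 0 (A 1 x) + P x = x" for x
    by (simp_all add: blinfun.add_left[symmetric] flip: blinfun_apply_blinfun_compose)
  have ker: "P x = x" if "A 1 x = 0" for x
    using Px(2)[of x] that by simp
  have "projection_onto_along P (ker_op (A 1)) (ran_op (A 1))"
    unfolding projection_onto_along_def
  proof (intro conjI)
    show "clinear_op P" unfolding P_def by (intro clinear_op_compose clinear_N clinear_T)
    show "P o\<^sub>L P = P" by (rule blinfun_eqI) (simp add: ker AP)
    show "ran_op P = ker_op (A 1)"
      unfolding ran_op_def ker_op_def using AP ker by (auto intro: range_eqI[OF sym])
    show "ker_op P = ran_op (A 1)"
    proof (intro set_eqI iffI)
      fix x assume "x \<in> ker_op P"
      then show "x \<in> ran_op (A 1)"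
        using Px(1)[of x] by (auto simp: ker_op_def ran_op_def intro: range_eqI[OF sym])
    qed (auto simp: ker_op_def ran_op_def PA)
  qed
  then show ?thesis by (simp only: P_def)
qed

text \<open>Subtracting the projection from \<open>T\<close> moves the eigenvalue \<open>1\<close> to \<open>0\<close>, so the modified pencil is
  invertible at \<open>1\<close> as well.\<close>

lemma deflated_invertible:
  assumes P: "projection_onto_along P (ker_op (A 1)) (ran_op (A 1))" and z: "z \<in> ball 0 \<rho>"
  shows "T o\<^sub>L P = P" "P o\<^sub>L T = P" "invertible_op (id_blinfun - z *\<^sub>C (T - P))"
proof -
  have clin: "clinear_op P" and PP: "P o\<^sub>L P = P" and ran: "range P = ker_op (A 1)"
    and ker: "ker_op P = range (A 1)"
    using P by (auto simp: projection_onto_along_def ran_op_def)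
  have PP': "P (P x) = P x" for x
    using PP by (simp flip: blinfun_apply_blinfun_compose)
  have TP: "T (P x) = P x" for x
  proof -
    have "P x \<in> ker_op (A 1)" using ran by blast
    then show ?thesis by (simp add: ker_op_def A1 blinfun.diff_left)
  qed
  have PT: "P (T x) = P x" for x
  proof -
    have "A 1 x \<in> ker_op P" using ker by blast
    then show ?thesis by (simp add: ker_op_def A1 blinfun.diff_left blinfun.diff_right)
  qed
  show "T o\<^sub>L P = P" "P o\<^sub>L T = P"
    by (auto intro!: blinfun_eqI simp: TP PT)
  have fix_ker: "P x = x" if "A 1 x = 0" for x
  proof -
    have "x \<in> range P" using that ran by (simp add: ker_op_def)
    then show ?thesis using PP' by auto
  qed
  \<comment> \<open>On the kernel of \<open>P\<close>, which is the range of \<open>A 1\<close>, the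
    pencil stays injective even at \<open>z = 1\<close>, and it still attains every value there.
    These two facts replace invertibility at 1.\<close>
  have inj_A: "x = 0" if "A z x = 0" "P x = 0" for x
  proof (cases "z = 1")
    case True
    then show ?thesis using that fix_ker by simp
  next
    case False
    then have "inverse_op (A z) (op_inv (A z))"
      using z by (intro inverse_op_op_inv invertible) simp
    from inverse_op_apply(2)[OF this, of x] show ?thesis using that(1) by (simp add: blinfun.zero_right)
  qed
  have surj_A: "\<exists>u. A z u = y" if "P y = 0" for y
  proof (cases "z = 1")
    case True
    have "y \<in> range (A 1)" using that ker by (auto simp: ker_op_def)
    then show ?thesis using True by auto
  next
    case False
    then have "inverse_op (A z) (op_inv (A z))"
      using z by (intro inverse_op_op_inv invertible) simp
    from inverse_op_apply(1)[OF this] show ?thesis by blast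
  qed
  define B where "B = id_blinfun - z *\<^sub>C (T - P)"
  have B: "B x = x - z *\<^sub>C (T x - P x)" and Az: "A z x = x - z *\<^sub>C T x" for x
    by (simp_all add: B_def A blinfun.diff_left scaleC_blinfun.rep_eq)
  have P_scaleC: "P (c *\<^sub>C x) = c *\<^sub>C P x" for c x
    using clin by (simp add: clinear_op_def)
  have PB: "P (B x) = P x" for x
    by (simp add: B blinfun.diff_right P_scaleC PT PP' scaleC.zero_right)
  have "inj (blinfun_apply B)"
    unfolding linear_injective_0[OF bounded_linear.linear[OF blinfun.bounded_linear_right]]
  proof (intro allI impI)
    fix x assume x: "B x = 0"
    then have Px: "P x = 0" using PB[of x] by (simp add: blinfun.zero_right)
    show "x = 0"
      by (rule inj_A) (use x Px in \<open>simp_all add: B Az\<close>)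
  qed
  moreover have "surj (blinfun_apply B)"
    unfolding surj_def
  proof
    fix y
    have "P (y - P y) = 0" by (simp add: blinfun.diff_right PP')
    from surj_A[OF this] obtain u where u: "A z u = y - P y" by (elim exE)
    have "P (A z u) = P u - z *\<^sub>C P u"
      by (simp add: Az blinfun.diff_right P_scaleC PT)
    moreover have "P (A z u) = 0"
      by (simp add: u blinfun.diff_right PP')
    ultimately have zPu: "z *\<^sub>C P u = P u" by simp
    \<comment> \<open>The witness exchanges the kernel component \<open>P u\<close> for
      \<open>P y\<close>. The remainder \<open>z *\<^sub>C P u - P u\<close> is 0 by the previous
      line, whether \<open>z\<close> is 1 or not.\<close>
    have "B (u - P u + P y) = A z u + (z *\<^sub>C P u - P u) + P y"
      by (simp add: B Az blinfun.diff_right blinfun.add_right PP' TP scaleC.diff_right)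
    then have "B (u - P u + P y) = y"
      by (simp only: zPu u) simp
    then show "\<exists>x. y = B x" by (intro exI) (rule sym)
  qed
  ultimately have "bij (blinfun_apply B)" by (simp add: bij_def)
  then show "invertible_op (id_blinfun - z *\<^sub>C (T - P))"
    unfolding B_def[symmetric]
    by (subst invertible_op_iff_bij)
      (auto simp: B_def intro!: clinear_op_diff clinear_op_scaleC clinear_op_id clin clinear_T)
qed

lemma direct_sum_imp:
  assumes "space_is_direct_sum (ran_op (A 1)) (ker_op (A 1))"
  defines "P \<equiv> N (-1) o\<^sub>L T"
  shows "has_simple_pole (\<lambda>z. op_inv (A z)) 1"
    and "projection_onto_along P (ker_op (A 1)) (ran_op (A 1))"
    and "\<exists>G H. vholomorphic_on G (ball 0 \<rho>) \<and>
      (\<forall>z \<in> ball 0 \<rho> - {1}. invertible_op (A z) \<and> G z = (1 - z) *\<^sub>C op_inv (A z)) \<and>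
      continues_regular_part H (\<lambda>j. - N j) 1 (ball 0 \<rho>) \<and>
      (\<forall>z \<in> ball 0 \<rho>. clinear_op (H z) \<and> G z = P + (1 - z) *\<^sub>C H z) \<and>
      maclaurin_sums_on G (ball 0 \<rho>) \<and> maclaurin_sums_on H (ball 0 \<rho>)"
proof -
  obtain P0 where proj: "projection_onto_along P0 (ker_op (A 1)) (ran_op (A 1))"
    using direct_sum_projection[OF assms(1)] by blast
  have clin_P0: "clinear_op P0" and P0P0: "P0 o\<^sub>L P0 = P0"
    using proj by (simp_all add: projection_onto_along_def)
  define S where "S = T - P0"
  define R where "R z = op_inv (id_blinfun - z *\<^sub>C S)" for z
  have zero_ball: "0 \<in> ball (0::complex) \<rho>" using \<rho> by simp
  note TP0 = deflated_invertible(1,2)[OF proj zero_ball]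
  interpret disc_resolvent S R \<rho>
  proof
    show "clinear_op S" unfolding S_def by (intro clinear_op_diff clinear_T clin_P0)
    show "inverse_op (id_blinfun - z *\<^sub>C S) (R z)" if "z \<in> ball 0 \<rho>" for z
      unfolding R_def S_def by (intro inverse_op_op_inv deflated_invertible[OF proj that])
  qed
  have P0S: "P0 o\<^sub>L S = 0" and SP0: "S o\<^sub>L P0 = 0"
    by (simp_all add: S_def compose.diff_left compose.diff_right TP0 P0P0)
  \<comment> \<open>\<open>S\<close> vanishes on the range of \<open>P0\<close> and maps into its
    kernel, so the resolvent of \<open>S\<close> does not change \<open>P0\<close> on either
    side.\<close>
  have P0R: "P0 o\<^sub>L R z = P0" and RP0: "R z o\<^sub>L P0 = P0" if "z \<in> ball 0 \<rho>" for z
  proof -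
    have "P0 o\<^sub>L (id_blinfun - z *\<^sub>C S) o\<^sub>L R z = P0"
      unfolding compose_assoc inverse_op_composeD(1)[OF inverse_resolvent[OF that]] by simp
    then show "P0 o\<^sub>L R z = P0"
      by (simp add: compose.diff_right compose_scaleC[OF clin_P0] P0S scaleC.zero_right)
    have "R z o\<^sub>L (id_blinfun - z *\<^sub>C S) o\<^sub>L P0 = P0"
      unfolding inverse_op_composeD(2)[OF inverse_resolvent[OF that]] by simp
    then show "R z o\<^sub>L P0 = P0"
      by (simp add: compose_assoc compose.diff_left scaleC_compose SP0 scaleC.zero_right)
  qed
  \<comment> \<open>The product form passes the power series of \<open>R\<close> on term by term; on
    the disc it agrees with \<open>R z - P0\<close>, which suits the algebra.\<close>
  define H where "H z = R z o\<^sub>L (id_blinfun - P0)" for z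
  have H: "H z = R z - P0" if "z \<in> ball 0 \<rho>" for z
    by (simp add: H_def compose.diff_right RP0[OF that])
  have clin_H: "clinear_op (H z)" if "z \<in> ball 0 \<rho>" for z
    unfolding H[OF that] by (intro clinear_op_diff clin_P0 inverse_op_composeD(3)[OF inverse_resolvent[OF that]])
  have F: "op_inv (A z) = inverse (1 - z) *\<^sub>C P0 + H z" if z: "z \<in> ball 0 \<rho> - {1}" for z
  proof (rule right_inverse_unique[symmetric])
    show "inverse_op (A z) (op_inv (A z))"
      by (intro inverse_op_op_inv invertible z)
    have AP0: "A z o\<^sub>L P0 = (1 - z) *\<^sub>C P0"
      by (simp add: A compose.diff_left scaleC_compose TP0 scaleC.diff_left)
    have A': "A z = (id_blinfun - z *\<^sub>C S) - z *\<^sub>C P0"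
      by (simp add: A S_def scaleC.diff_right)
    have "A z o\<^sub>L R z = id_blinfun - z *\<^sub>C P0"
      unfolding A' compose.diff_left[of "id_blinfun - z *\<^sub>C S"]
      using z by (simp add: inverse_op_composeD(1)[OF inverse_resolvent] scaleC_compose P0R)
    then have "A z o\<^sub>L H z = id_blinfun - P0"
      using z by (simp add: H compose.diff_right AP0 scaleC.diff_left)
    moreover have "A z o\<^sub>L (inverse (1 - z) *\<^sub>C P0) = P0"
      using z by (simp add: compose_scaleC[OF clinear_A] AP0 scaleC_scaleC)
    ultimately show "A z o\<^sub>L (inverse (1 - z) *\<^sub>C P0 + H z) = id_blinfun"
      by (simp add: compose.add_right)
  qed
  define h where "h k = op_power S k o\<^sub>L (id_blinfun - P0)" for k
  have H_sums: "(\<lambda>k. z ^ k *\<^sub>C h k) sums H z" if "z \<in> ball 0 \<rho>" for z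
    using bounded_linear.sums[OF compose.bounded_linear_left resolvent_power_series[OF that]]
    by (simp add: h_def H_def scaleC_compose)

  have one_ball: "1 \<in> ball (0::complex) \<rho>" using \<rho> by simp
  define R1 where "R1 = R 1"
  have R1: "inverse_op (id_blinfun - S) R1"
    using inverse_resolvent[OF one_ball] by (simp add: R1_def)
  have near: "1 + w \<in> ball 0 \<rho>" if "w \<in> ball 0 (\<rho> - 1)" for w :: complex
    using that norm_triangle_ineq[of 1 w] by simp
  \<comment> \<open>\<open>I - (1 + w) S\<close> factors as \<open>(I - S) (I - w R1 S)\<close>.
    Expanding around 1 is thus expanding the resolvent of \<open>R1 S\<close> around 0, on radius
    \<open>\<rho> - 1\<close>.\<close>
  interpret at_1: disc_resolvent "R1 o\<^sub>L S" "\<lambda>w. R (1 + w) o\<^sub>L (id_blinfun - S)" "\<rho> - 1"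
  proof
    show clin: "clinear_op (R1 o\<^sub>L S)"
      by (intro clinear_op_compose inverse_op_composeD(3)[OF R1] clinear_S)
    show "inverse_op (id_blinfun - w *\<^sub>C (R1 o\<^sub>L S)) (R (1 + w) o\<^sub>L (id_blinfun - S))"
      if w: "w \<in> ball 0 (\<rho> - 1)" for w
    proof (rule inverse_opI)
      define X where "X = id_blinfun - (1 + w) *\<^sub>C S"
      have X: "inverse_op X (R (1 + w))"
        unfolding X_def by (intro inverse_resolvent near w)
      have "X = (id_blinfun - S) - w *\<^sub>C S"
        by (simp add: X_def scaleC_add_left)
      then have "R1 o\<^sub>L X = (R1 o\<^sub>L (id_blinfun - S)) - (R1 o\<^sub>L (w *\<^sub>C S))"
        by (simp only: compose.diff_right)
      then have eq: "id_blinfun - w *\<^sub>C (R1 o\<^sub>L S) = R1 o\<^sub>L X"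
        by (simp only: inverse_op_composeD(2)[OF R1] compose_scaleC[OF inverse_op_composeD(3)[OF R1]])
      show "clinear_op (id_blinfun - w *\<^sub>C (R1 o\<^sub>L S))"
        by (intro clinear_op_diff clinear_op_id clinear_op_scaleC clin)
      have "R1 o\<^sub>L X o\<^sub>L (R (1 + w) o\<^sub>L (id_blinfun - S)) = R1 o\<^sub>L (X o\<^sub>L R (1 + w)) o\<^sub>L (id_blinfun - S)"
        by (simp only: compose_assoc)
      also have "\<dots> = id_blinfun"
        by (simp only: inverse_op_composeD(1)[OF X] inverse_op_composeD(2)[OF R1] id_blinfun_compose)
      finally show "id_blinfun - w *\<^sub>C (R1 o\<^sub>L S) o\<^sub>L (R (1 + w) o\<^sub>L (id_blinfun - S)) = id_blinfun"
        unfolding eq .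
      have "R (1 + w) o\<^sub>L (id_blinfun - S) o\<^sub>L (R1 o\<^sub>L X) = R (1 + w) o\<^sub>L ((id_blinfun - S) o\<^sub>L R1) o\<^sub>L X"
        by (simp only: compose_assoc)
      also have "\<dots> = id_blinfun"
        by (simp only: inverse_op_composeD(2)[OF X] inverse_op_composeD(1)[OF R1] id_blinfun_compose)
      finally show "R (1 + w) o\<^sub>L (id_blinfun - S) o\<^sub>L (id_blinfun - w *\<^sub>C (R1 o\<^sub>L S)) = id_blinfun"
        unfolding eq .
    qed
  qed
  \<comment> \<open>The sign at -1 comes from \<open>inverse (1 - z) = - inverse w\<close> for
    \<open>z = 1 + w\<close>. The factor \<open>R1\<close> in the regular part compensates
    \<open>I - S\<close> in the shifted resolvent.\<close>
  define a where "a j = (if j \<ge> 0 then op_power (R1 o\<^sub>L S) (nat j) o\<^sub>L (R1 o\<^sub>L (id_blinfun - P0))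
    else if j = -1 then - P0 else 0)" for j
  have H1_sums: "(\<lambda>n. w ^ n *\<^sub>C a (int n)) sums H (1 + w)" if w: "w \<in> ball 0 (\<rho> - 1)" for w
  proof -
    have "R (1 + w) o\<^sub>L (id_blinfun - S) o\<^sub>L (R1 o\<^sub>L (id_blinfun - P0)) =
        R (1 + w) o\<^sub>L ((id_blinfun - S) o\<^sub>L R1) o\<^sub>L (id_blinfun - P0)"
      by (simp only: compose_assoc)
    also have "\<dots> = H (1 + w)"
      by (simp only: inverse_op_composeD(1)[OF R1] id_blinfun_compose H_def)
    finally show ?thesis
      using bounded_linear.sums[OF compose.bounded_linear_left at_1.resolvent_power_series[OF w],
          of "R1 o\<^sub>L (id_blinfun - P0)"]
      by (simp add: a_def scaleC_compose)
  qed
  have a_laurent: "has_laurent_series (\<lambda>z. op_inv (A z)) a 1"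
    unfolding has_laurent_series_iff
  proof (intro exI[of _ "\<rho> - 1"] conjI allI impI)
    fix w assume w: "0 < cmod w \<and> cmod w < \<rho> - 1"
    have "(\<lambda>n. inverse w ^ Suc n *\<^sub>C a (- int (Suc n))) sums
        (\<Sum>n\<in>{0}. inverse w ^ Suc n *\<^sub>C a (- int (Suc n)))"
      by (rule sums_finite) (auto simp: a_def scaleC.zero_right)
    moreover have "(\<Sum>n\<in>{0}. inverse w ^ Suc n *\<^sub>C a (- int (Suc n))) = inverse (1 - (1 + w)) *\<^sub>C P0"
      by (simp add: a_def scaleC.minus_right scaleC.minus_left)
    ultimately have prin: "(\<lambda>n. inverse w ^ Suc n *\<^sub>C a (- int (Suc n))) sums (inverse (1 - (1 + w)) *\<^sub>C P0)"
      by simp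
    have "op_inv (A (1 + w)) = H (1 + w) + inverse (1 - (1 + w)) *\<^sub>C P0"
      using F[of "1 + w"] near_1[of w] w by (simp only: add.commute[of "H (1 + w)"]) simp
    then show "\<exists>Ra Sa. (\<lambda>n. w ^ n *\<^sub>C a (int n)) sums Ra \<and>
        (\<lambda>n. inverse w ^ Suc n *\<^sub>C a (- int (Suc n))) sums Sa \<and> op_inv (A (1 + w)) = Ra + Sa"
      using H1_sums[of w] w prin by (intro exI conjI) auto
  qed (use \<rho> in simp)
  have N: "- N j = a j" for j
    using has_laurent_series_unique[OF laurent a_laurent] by meson
  have "N (-1) = P0"
    using N[of "-1"] by (simp add: a_def)
  then have P: "P = P0"
    by (simp add: P_def TP0)
  show "projection_onto_along P (ker_op (A 1)) (ran_op (A 1))"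
    unfolding P by (rule proj)
  \<comment> \<open>This keeps the singularity from being removable: with \<open>P0 = 0\<close> one
    has \<open>S = T\<close>, and \<open>A 1\<close> would be invertible.\<close>
  have "P0 \<noteq> 0"
  proof
    assume "P0 = 0"
    then have "A 1 = id_blinfun - S" by (simp add: A1 S_def)
    then show False
      using not_invertible R1 unfolding invertible_op_def by auto
  qed
  then show "has_simple_pole (\<lambda>z. op_inv (A z)) 1"
    unfolding has_pole_of_order_def
    by (intro conjI exI[of _ a] a_laurent) (auto simp: a_def)

  define G where "G z = P0 + (1 - z) *\<^sub>C H z" for z
  \<comment> \<open>Multiplication by \<open>1 - z\<close> turns the coefficients \<open>h\<close>
    into consecutive differences; \<open>P0\<close> joins the constant term.\<close>
  define g where "g k = (case k of 0 \<Rightarrow> P0 + h 0 | Suc k \<Rightarrow> h (Suc k) - h k)" for k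
  have G_sums: "(\<lambda>k. z ^ k *\<^sub>C g k) sums G z" if z: "z \<in> ball 0 \<rho>" for z
  proof -
    have "(\<lambda>k. z ^ Suc k *\<^sub>C h (Suc k)) sums (H z - h 0)"
      using H_sums[OF z] sums_Suc_iff[of "\<lambda>k. z ^ k *\<^sub>C h k" "H z - h 0"] by simp
    moreover have "(\<lambda>k. z ^ Suc k *\<^sub>C h k) sums (z *\<^sub>C H z)"
      using bounded_linear.sums[OF scaleC.bounded_linear_right H_sums[OF z], of z]
      by (simp add: scaleC_scaleC)
    ultimately have "(\<lambda>k. z ^ Suc k *\<^sub>C g (Suc k)) sums (H z - h 0 - z *\<^sub>C H z)"
      unfolding g_def nat.case scaleC.diff_right by (rule sums_diff)
    then have "(\<lambda>k. z ^ k *\<^sub>C g k) sums (H z - h 0 - z *\<^sub>C H z + g 0)"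
      using sums_Suc_iff[of "\<lambda>k. z ^ k *\<^sub>C g k"] by simp
    moreover have "H z - h 0 - z *\<^sub>C H z + g 0 = G z"
      by (simp add: g_def G_def scaleC.diff_left)
    ultimately show ?thesis by simp
  qed
  show "\<exists>G H. vholomorphic_on G (ball 0 \<rho>) \<and>
      (\<forall>z \<in> ball 0 \<rho> - {1}. invertible_op (A z) \<and> G z = (1 - z) *\<^sub>C op_inv (A z)) \<and>
      continues_regular_part H (\<lambda>j. - N j) 1 (ball 0 \<rho>) \<and>
      (\<forall>z \<in> ball 0 \<rho>. clinear_op (H z) \<and> G z = P + (1 - z) *\<^sub>C H z) \<and>
      maclaurin_sums_on G (ball 0 \<rho>) \<and> maclaurin_sums_on H (ball 0 \<rho>)"
  proof (rule exI[of _ G], rule exI[of _ H], intro conjI ballI)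
    show "vholomorphic_on G (ball 0 \<rho>)" by (rule power_series_vholomorphic[OF G_sums])
    show "maclaurin_sums_on G (ball 0 \<rho>)" by (rule power_series_maclaurin_sums_on[OF G_sums])
    show "maclaurin_sums_on H (ball 0 \<rho>)" by (rule power_series_maclaurin_sums_on[OF H_sums])
    show "G z = P + (1 - z) *\<^sub>C H z" for z by (simp only: G_def P)
    show "invertible_op (A z)" if "z \<in> ball 0 \<rho> - {1}" for z by (rule invertible[OF that])
    show "G z = (1 - z) *\<^sub>C op_inv (A z)" if "z \<in> ball 0 \<rho> - {1}" for z
      using that by (simp add: G_def F scaleC_add_right scaleC_scaleC)
    show "clinear_op (H z)" if "z \<in> ball 0 \<rho>" for z by (rule clin_H[OF that])
    show "continues_regular_part H (\<lambda>j. - N j) 1 (ball 0 \<rho>)"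
      unfolding continues_regular_part_def N
    proof (intro conjI exI[of _ "\<rho> - 1"] ballI)
      show "vholomorphic_on H (ball 0 \<rho>)" by (rule power_series_vholomorphic[OF H_sums])
      show "(\<lambda>n. (z - 1) ^ n *\<^sub>C a (int n)) sums H z" if "z \<in> ball 1 (\<rho> - 1)" for z
        using H1_sums[of "z - 1"] that by (simp add: dist_norm norm_minus_commute)
    qed (use \<rho> in simp)
  qed
qed

theorem simple_pole_characterization:
  defines "P \<equiv> N (-1) o\<^sub>L T"
  defines "simple_pole \<equiv> has_simple_pole (\<lambda>z. op_inv (A z)) 1"
    and "projection \<equiv> projection_onto_along P (ker_op (A 1)) (ran_op (A 1))"
    and "direct_sum \<equiv> space_is_direct_sum (ran_op (A 1)) (ker_op (A 1))"
  shows "(simple_pole \<longleftrightarrow> projection) \<and> (projection \<longleftrightarrow> direct_sum) \<and>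
    (simple_pole \<or> projection \<or> direct_sum \<longrightarrow>
      (\<exists>G H. vholomorphic_on G (ball 0 \<rho>) \<and>
        (\<forall>z \<in> ball 0 \<rho> - {1}. invertible_op (A z) \<and> G z = (1 - z) *\<^sub>C op_inv (A z)) \<and>
        continues_regular_part H (\<lambda>j. - N j) 1 (ball 0 \<rho>) \<and>
        (\<forall>z \<in> ball 0 \<rho>. clinear_op (H z) \<and> G z = P + (1 - z) *\<^sub>C H z) \<and>
        maclaurin_sums_on G (ball 0 \<rho>) \<and> maclaurin_sums_on H (ball 0 \<rho>)))"
proof -
  have 1: "simple_pole \<Longrightarrow> projection"
    unfolding simple_pole_def projection_def P_def by (rule simple_pole_imp_projection)
  have 2: "projection \<Longrightarrow> direct_sum"
    unfolding projection_def direct_sum_def by (rule projection_direct_sum)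
  have 3: "direct_sum \<Longrightarrow> simple_pole"
    unfolding simple_pole_def direct_sum_def by (rule direct_sum_imp(1))
  note 4 = direct_sum_imp(3)[folded P_def direct_sum_def]
  show ?thesis
    using 1 2 3 4 by argo
qed

end

section \<open>The spectrum of the companion pencil\<close>

lemma coord_companion:
  fixes x :: "('b::real_normed_vector, 'p::finite) power_space"
  shows "coord (companion \<Phi> x) i = (if i = 1 then \<Sum>j = 1..CARD('p). \<Phi> j (coord x j)
    else if i \<in> {2..CARD('p)} then coord x (i - 1) else 0)"
  by (simp add: companion.rep_eq companion_map.rep_eq)

lemma clinear_op_companion:
  fixes \<Phi> :: "nat \<Rightarrow> ('b::complex_normed_vector \<Rightarrow>\<^sub>L 'b)"
  assumes "\<And>j. j \<in> {1..CARD('p)} \<Longrightarrow> clinear_op (\<Phi> j)"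
  shows "clinear_op (companion \<Phi> :: ('b, 'p::finite) power_space \<Rightarrow>\<^sub>L ('b, 'p) power_space)"
  unfolding clinear_op_def
proof (intro allI power_space_eqI)
  fix c and x :: "('b, 'p) power_space" and i
  have "(\<Sum>j = 1..CARD('p). \<Phi> j (c *\<^sub>C coord x j)) = c *\<^sub>C (\<Sum>j = 1..CARD('p). \<Phi> j (coord x j))"
    using assms by (simp add: clinear_op_def scaleC.sum_right)
  then show "coord (companion \<Phi> (c *\<^sub>C x)) i = coord (c *\<^sub>C companion \<Phi> x) i"
    by (simp add: coord_companion scaleC_power_space.rep_eq scaleC.zero_right)
qed

text \<open>Solving \<open>x\<^sub>i - z x\<^sub>i\<^sub>-\<^sub>1 = y\<^sub>i\<close> for \<open>i \<ge> 2\<close> gives \<open>x\<^sub>i = z\<^sup>i\<^sup>-\<^sup>1 x\<^sub>1 + forcing z y (i - 1)\<close>.\<close>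

primrec forcing :: "complex \<Rightarrow> ('b::complex_normed_vector, 'p::finite) power_space \<Rightarrow> nat \<Rightarrow> 'b" where
  "forcing z y 0 = 0"
| "forcing z y (Suc i) = z *\<^sub>C forcing z y i + coord y (Suc (Suc i))"

text \<open>The only candidate with first coordinate \<open>b\<close> for a solution with right side
  \<open>y\<close>: it meets every row of the equation except possibly the first.\<close>

definition propagate ::
    "complex \<Rightarrow> ('b::complex_normed_vector, 'p::finite) power_space \<Rightarrow> 'b \<Rightarrow> ('b, 'p) power_space" where
  "propagate z y b = Abs_power_space
     (\<lambda>i. if i \<in> {1..CARD('p)} then z ^ (i - 1) *\<^sub>C b + forcing z y (i - 1) else 0)"

lemma coord_propagate:
  fixes y :: "('b::complex_normed_vector, 'p::finite) power_space"
  assumes "i < CARD('p)"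
  shows "coord (propagate z y b) (Suc i) = z ^ i *\<^sub>C b + forcing z y i"
  using assms by (simp add: propagate_def Abs_power_space_inverse)

text \<open>All rows but the first form a recursion started by \<open>coord x 1\<close>. Inserting
  its solution into row 1 merges the outer \<open>z\<close> with \<open>z ^ (j - 1)\<close>, which
  reproduces the autoregressive pencil; the forcing terms move to the right.\<close>

lemma companion_pencil_eq_iff:
  fixes \<Phi> :: "nat \<Rightarrow> ('b::complex_normed_vector \<Rightarrow>\<^sub>L 'b)" and x y :: "('b, 'p::finite) power_space"
  assumes op: "\<And>j. j \<in> {1..CARD('p)} \<Longrightarrow> clinear_op (\<Phi> j)"
  shows "companion_pencil \<Phi> z x = y \<longleftrightarrow> x = propagate z y (coord x 1) \<and>
    ar_pencil CARD('p) \<Phi> z (coord x 1) =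
      coord y 1 + z *\<^sub>C (\<Sum>j = 1..CARD('p). \<Phi> j (forcing z y (j - 1)))"
    (is "_ \<longleftrightarrow> ?tail \<and> ?head")
proof -
  define p where "p = CARD('p)"
  have p: "p \<ge> 1" by (simp add: p_def Suc_leI)
  have coord_pencil: "coord (companion_pencil \<Phi> z x) i = coord x i - z *\<^sub>C coord (companion \<Phi> x) i" for i
    by (simp add: companion_pencil_def blinfun.diff_left minus_power_space.rep_eq
        scaleC_blinfun.rep_eq scaleC_power_space.rep_eq)
  have eq_iff: "u = v \<longleftrightarrow> coord u 1 = coord v 1 \<and> (\<forall>i. Suc i < p \<longrightarrow> coord u (Suc (Suc i)) = coord v (Suc (Suc i)))"
    for u v :: "('b, 'p) power_space"
  proof (intro iffI power_space_eqI)
    fix j assume uv: "coord u 1 = coord v 1 \<and> (\<forall>i. Suc i < p \<longrightarrow> coord u (Suc (Suc i)) = coord v (Suc (Suc i)))"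
      and j: "j \<in> {1..CARD('p)}"
    show "coord u j = coord v j"
    proof (cases "j = 1")
      case False
      then obtain i where "j = Suc (Suc i)" "Suc i < p"
        using j by (cases j; cases "j - 1") (auto simp: p_def)
      then show ?thesis using uv by simp
    qed (use uv in simp)
  qed simp
  have rec: "(\<forall>i. Suc i < p \<longrightarrow> coord x (Suc (Suc i)) - z *\<^sub>C coord x (Suc i) = coord y (Suc (Suc i))) \<longleftrightarrow>
      (\<forall>i < p. coord x (Suc i) = z ^ i *\<^sub>C coord x 1 + forcing z y i)" (is "?rec \<longleftrightarrow> ?sol")
  proof
    assume rec: ?rec
    show ?sol
    proof (intro allI impI)
      fix i assume "i < p"
      then show "coord x (Suc i) = z ^ i *\<^sub>C coord x 1 + forcing z y i"
      proof (induction i)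
        case (Suc i)
        have "coord x (Suc (Suc i)) = coord y (Suc (Suc i)) + z *\<^sub>C coord x (Suc i)"
          using rec Suc.prems by (simp add: diff_eq_eq)
        then show ?case
          using Suc by (simp add: scaleC_add_right scaleC_scaleC)
      qed simp
    qed
  next
    assume sol: ?sol
    show ?rec
    proof (intro allI impI)
      fix i assume "Suc i < p"
      then have "coord x (Suc i) = z ^ i *\<^sub>C coord x 1 + forcing z y i"
        "coord x (Suc (Suc i)) = z ^ Suc i *\<^sub>C coord x 1 + forcing z y (Suc i)"
        using sol Suc_lessD by blast+
      then show "coord x (Suc (Suc i)) - z *\<^sub>C coord x (Suc i) = coord y (Suc (Suc i))"
        by (simp add: scaleC_add_right scaleC_scaleC)
    qed
  qed
  have tail: "?tail \<longleftrightarrow> (\<forall>i < p. coord x (Suc i) = z ^ i *\<^sub>C coord x 1 + forcing z y i)"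
  proof
    assume t: ?tail
    show "\<forall>i < p. coord x (Suc i) = z ^ i *\<^sub>C coord x 1 + forcing z y i"
    proof (intro allI impI)
      fix i assume "i < p"
      have "coord x (Suc i) = coord (propagate z y (coord x 1)) (Suc i)"
        by (rule arg_cong[OF t])
      then show "coord x (Suc i) = z ^ i *\<^sub>C coord x 1 + forcing z y i"
        using \<open>i < p\<close> by (simp only: coord_propagate p_def)
    qed
  next
    assume s: "\<forall>i < p. coord x (Suc i) = z ^ i *\<^sub>C coord x 1 + forcing z y i"
    show ?tail
    proof (rule power_space_eqI)
      fix j assume "j \<in> {1..CARD('p)}"
      then obtain i where "j = Suc i" "i < p" by (cases j) (auto simp: p_def)
      then show "coord x j = coord (propagate z y (coord x 1)) j"
        using s[rule_format, OF \<open>i < p\<close>] by (simp only: coord_propagate p_def)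
    qed
  qed
  \<comment> \<open>Row 1 contains all coordinates, so it reduces to an equation for
    \<open>coord x 1\<close> only once the other rows are solved.\<close>
  have head: "?head \<longleftrightarrow> coord (companion_pencil \<Phi> z x) 1 = coord y 1" if t: ?tail
  proof -
    have "\<Phi> j (coord x j) = z ^ (j - 1) *\<^sub>C \<Phi> j (coord x 1) + \<Phi> j (forcing z y (j - 1))"
      if "j \<in> {1..CARD('p)}" for j
    proof -
      obtain i where "j = Suc i" "i < p" using \<open>j \<in> _\<close> by (cases j) (auto simp: p_def)
      then have "coord x j = z ^ (j - 1) *\<^sub>C coord x 1 + forcing z y (j - 1)"
        using tail[THEN iffD1, OF t, rule_format, of i] by (simp only: diff_Suc_1)
      then show ?thesis
        using op[OF that] by (simp add: blinfun.add_right clinear_op_def)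
    qed
    then have "z *\<^sub>C (\<Sum>j = 1..CARD('p). \<Phi> j (coord x j)) =
        z *\<^sub>C (\<Sum>j = 1..CARD('p). z ^ (j - 1) *\<^sub>C \<Phi> j (coord x 1) + \<Phi> j (forcing z y (j - 1)))"
      by simp
    also have "\<dots> = (\<Sum>j = 1..CARD('p). z ^ j *\<^sub>C \<Phi> j (coord x 1)) +
        z *\<^sub>C (\<Sum>j = 1..CARD('p). \<Phi> j (forcing z y (j - 1)))"
      unfolding sum.distrib scaleC_add_right scaleC.sum_right[of z]
      by (intro arg_cong2[of _ _ _ _ "(+)"] sum.cong refl)
        (auto simp: scaleC_scaleC power_eq_if)
    finally show ?thesis
      by (auto simp: coord_pencil coord_companion ar_pencil_def blinfun.diff_left blinfun.sum_left
          scaleC_blinfun.rep_eq algebra_simps)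
  qed
  have "companion_pencil \<Phi> z x = y \<longleftrightarrow> coord (companion_pencil \<Phi> z x) 1 = coord y 1 \<and> ?tail"
    unfolding eq_iff[of "companion_pencil \<Phi> z x"] tail rec[symmetric]
    by (auto simp: coord_pencil coord_companion p_def)
  then show ?thesis using head by blast
qed

text \<open>For fixed \<open>y\<close>, solutions correspond through \<open>coord x 1\<close> and
  \<open>propagate z y b\<close>. Bijectivity is unique solvability for all right sides, and since
  \<open>rhs\<close> is onto, quantifying over \<open>y\<close> or over the values
  \<open>rhs y\<close> is the same.\<close>

lemma bij_companion_pencil_iff:
  fixes \<Phi> :: "nat \<Rightarrow> ('b::complex_normed_vector \<Rightarrow>\<^sub>L 'b)"
  assumes op: "\<And>j. j \<in> {1..CARD('p)} \<Longrightarrow> clinear_op (\<Phi> j)"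
  shows "bij (blinfun_apply (companion_pencil \<Phi> z :: ('b, 'p::finite) power_space \<Rightarrow>\<^sub>L _)) \<longleftrightarrow>
    bij (blinfun_apply (ar_pencil CARD('p) \<Phi> z))"
proof -
  define rhs where "rhs y = coord y 1 + z *\<^sub>C (\<Sum>j = 1..CARD('p). \<Phi> j (forcing z y (j - 1)))"
    for y :: "('b, 'p) power_space"
  have coord_1: "coord (propagate z y b) 1 = b" for y :: "('b, 'p) power_space" and b
    using coord_propagate[of 0 z y b] by simp
  have eq_iff: "companion_pencil \<Phi> z x = y \<longleftrightarrow>
      x = propagate z y (coord x 1) \<and> ar_pencil CARD('p) \<Phi> z (coord x 1) = rhs y"
    for x y :: "('b, 'p) power_space"
    unfolding rhs_def by (rule companion_pencil_eq_iff[OF op])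
  have unique: "(\<exists>!x :: ('b, 'p) power_space. companion_pencil \<Phi> z x = y) \<longleftrightarrow>
      (\<exists>!b. ar_pencil CARD('p) \<Phi> z b = rhs y)" for y
  proof
    assume "\<exists>!x :: ('b, 'p) power_space. companion_pencil \<Phi> z x = y"
    then obtain x where x: "companion_pencil \<Phi> z x = y"
      and x_unique: "\<And>x'. companion_pencil \<Phi> z x' = y \<Longrightarrow> x' = x"
      by blast
    show "\<exists>!b. ar_pencil CARD('p) \<Phi> z b = rhs y"
    proof (rule ex1I[of _ "coord x 1"])
      show "ar_pencil CARD('p) \<Phi> z (coord x 1) = rhs y"
        using x eq_iff by blast
      fix b assume b: "ar_pencil CARD('p) \<Phi> z b = rhs y"
      have "propagate z y b = x"
        by (rule x_unique) (simp add: eq_iff coord_1 b del: One_nat_def)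
      then show "b = coord x 1" using coord_1[of y b] by simp
    qed
  next
    assume "\<exists>!b. ar_pencil CARD('p) \<Phi> z b = rhs y"
    then obtain b where b: "ar_pencil CARD('p) \<Phi> z b = rhs y"
      and b_unique: "\<And>b'. ar_pencil CARD('p) \<Phi> z b' = rhs y \<Longrightarrow> b' = b"
      by blast
    show "\<exists>!x :: ('b, 'p) power_space. companion_pencil \<Phi> z x = y"
    proof (rule ex1I[of _ "propagate z y b"])
      show "companion_pencil \<Phi> z (propagate z y b) = y"
        by (simp add: eq_iff coord_1 b del: One_nat_def)
      fix x :: "('b, 'p) power_space" assume "companion_pencil \<Phi> z x = y"
      then show "x = propagate z y b"
        using eq_iff[of x y] b_unique[of "coord x 1"] by simp
    qed
  qed
  \<comment> \<open>The witness is \<open>(c, 0, ..., 0)\<close>: forcing reads only coordinates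
    from 2 on, hence vanishes.\<close>
  have "\<exists>y. rhs y = c" for c
  proof
    define y :: "('b, 'p) power_space" where "y = Abs_power_space (\<lambda>i. if i = 1 then c else 0)"
    have y: "coord y i = (if i = 1 then c else 0)" for i
      unfolding y_def by (subst Abs_power_space_inverse) (auto simp: Suc_leI)
    have "forcing z y i = 0" for i
      by (induction i) (simp_all add: y scaleC.zero_right)
    then show "rhs y = c"
      by (simp add: rhs_def y blinfun.zero_right scaleC.zero_right)
  qed
  then have surj: "(\<forall>y. Q (rhs y)) \<longleftrightarrow> (\<forall>c. Q c)" for Q
    by (metis (full_types))
  show ?thesis
    unfolding bij_iff unique by (rule surj)
qed

lemma clinear_op_ar_pencil:
  assumes "\<And>j. j \<in> {1..p} \<Longrightarrow> clinear_op (\<Phi> j)"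
  shows "clinear_op (ar_pencil p \<Phi> z)"
  using assms
  by (simp add: clinear_op_def ar_pencil_def blinfun.diff_left blinfun.sum_left scaleC_blinfun.rep_eq
      scaleC.diff_right scaleC.sum_right scaleC_scaleC mult.commute)

lemma clinear_op_companion_pencil:
  fixes \<Phi> :: "nat \<Rightarrow> ('b::complex_normed_vector \<Rightarrow>\<^sub>L 'b)"
  assumes "\<And>j. j \<in> {1..CARD('p)} \<Longrightarrow> clinear_op (\<Phi> j)"
  shows "clinear_op (companion_pencil \<Phi> z :: ('b, 'p::finite) power_space \<Rightarrow>\<^sub>L _)"
  unfolding companion_pencil_def
  using assms by (intro clinear_op_diff clinear_op_id clinear_op_scaleC clinear_op_companion)

lemma spectrum_companion_pencil:
  fixes \<Phi> :: "nat \<Rightarrow> ('b::complex_banach \<Rightarrow>\<^sub>L 'b)"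
  assumes op: "\<And>j. j \<in> {1..CARD('p)} \<Longrightarrow> clinear_op (\<Phi> j)"
  shows "spectrum_of (companion_pencil \<Phi> :: complex \<Rightarrow> ('b, 'p::finite) power_space \<Rightarrow>\<^sub>L _) =
    spectrum_of (ar_pencil CARD('p) \<Phi>)"
proof -
  have "invertible_op (companion_pencil \<Phi> z :: ('b, 'p) power_space \<Rightarrow>\<^sub>L _) \<longleftrightarrow>
      invertible_op (ar_pencil CARD('p) \<Phi> z)" for z
  proof -
    have "clinear_op (companion_pencil \<Phi> z :: ('b, 'p) power_space \<Rightarrow>\<^sub>L _)"
      by (rule clinear_op_companion_pencil[OF op])
    moreover have "clinear_op (ar_pencil CARD('p) \<Phi> z)"
      by (rule clinear_op_ar_pencil[OF op])
    moreover have "bij (blinfun_apply (companion_pencil \<Phi> z :: ('b, 'p) power_space \<Rightarrow>\<^sub>L _)) \<longleftrightarrow>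
        bij (blinfun_apply (ar_pencil CARD('p) \<Phi> z))"
      by (rule bij_companion_pencil_iff[OF op])
    ultimately show ?thesis
      by (simp only: invertible_op_iff_bij)
  qed
  then show ?thesis by (simp add: spectrum_of_def)
qed

theorem proposition3p2:
  fixes \<Phi> :: "nat \<Rightarrow> ('b::complex_banach \<Rightarrow>\<^sub>L 'b)"
    and N :: "int \<Rightarrow> (('b, 'p::finite) power_space \<Rightarrow>\<^sub>L ('b, 'p) power_space)"
    and \<Phi>c :: "complex \<Rightarrow> (('b, 'p) power_space \<Rightarrow>\<^sub>L ('b, 'p) power_space)"
    and P :: "('b, 'p) power_space \<Rightarrow>\<^sub>L ('b, 'p) power_space"
  assumes separable: "separable_space (euclidean :: 'b topology)"
    and op: "\<And>j. j \<in> {1..CARD('p)} \<Longrightarrow> clinear_op (\<Phi> j)"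
    and unit_root: "unit_root (ar_pencil CARD('p) \<Phi>)"
    and pencil: "\<Phi>c = companion_pencil \<Phi>"
    and N_op: "\<And>j. clinear_op (N j)"
    and laurent: "has_laurent_series (\<lambda>z. op_inv (\<Phi>c z)) (\<lambda>j. - N j) 1"
    and P: "P = N (-1) o\<^sub>L companion \<Phi>"
  defines "simple_pole \<equiv> has_simple_pole (\<lambda>z. op_inv (\<Phi>c z)) 1"
    and "projection \<equiv> projection_onto_along P (ker_op (\<Phi>c 1)) (ran_op (\<Phi>c 1))"
    and "direct_sum \<equiv> space_is_direct_sum (ran_op (\<Phi>c 1)) (ker_op (\<Phi>c 1))"
  shows "(simple_pole \<longleftrightarrow> projection) \<and> (projection \<longleftrightarrow> direct_sum) \<and>
    (simple_pole \<or> projection \<or> direct_sum \<longrightarrow>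
      (\<exists>\<eta>>0. \<exists>G H.
         vholomorphic_on G (ball 0 (1 + \<eta>)) \<and>
         (\<forall>z \<in> ball 0 (1 + \<eta>) - {1}. invertible_op (\<Phi>c z) \<and> G z = (1 - z) *\<^sub>C op_inv (\<Phi>c z)) \<and>
         continues_regular_part H (\<lambda>j. - N j) 1 (ball 0 (1 + \<eta>)) \<and>
         (\<forall>z \<in> ball 0 (1 + \<eta>). clinear_op (H z) \<and> G z = P + (1 - z) *\<^sub>C H z) \<and>
         maclaurin_sums_on G (ball 0 (1 + \<eta>)) \<and>
         maclaurin_sums_on H (ball 0 (1 + \<eta>))))"
proof -
  \<comment> \<open>The same \<open>\<eta>\<close> serves in the conclusion: as the spectra agree, 1
    is the only singular point of the companion pencil in this disc.\<close>
  obtain \<eta> where \<eta>: "\<eta> > 0" "spectrum_of (ar_pencil CARD('p) \<Phi>) \<inter> ball 0 (1 + \<eta>) = {1}"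
    using unit_root unfolding unit_root_def by blast
  have spectrum: "spectrum_of \<Phi>c = spectrum_of (ar_pencil CARD('p) \<Phi>)"
    unfolding pencil by (rule spectrum_companion_pencil[OF op])
  interpret unit_disc_pencil "companion \<Phi>" "1 + \<eta>" N \<Phi>c
  proof
    show "clinear_op (companion \<Phi> :: ('b, 'p) power_space \<Rightarrow>\<^sub>L _)"
      by (rule clinear_op_companion[OF op])
    show "\<Phi>c z = id_blinfun - z *\<^sub>C companion \<Phi>" for z
      by (simp add: pencil companion_pencil_def)
    have "z \<notin> spectrum_of \<Phi>c" if "z \<in> ball 0 (1 + \<eta>) - {1}" for z
      unfolding spectrum using \<eta>(2) that by blast
    then show "invertible_op (\<Phi>c z)" if "z \<in> ball 0 (1 + \<eta>) - {1}" for z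
      using that unfolding spectrum_of_def by blast
    have "1 \<in> spectrum_of \<Phi>c"
      unfolding spectrum using \<eta>(2) by blast
    then show "\<not> invertible_op (\<Phi>c 1)"
      unfolding spectrum_of_def by blast
  qed (use N_op laurent \<eta>(1) in auto)
  show ?thesis
    using simple_pole_characterization[folded P] \<eta>(1)
    unfolding simple_pole_def projection_def direct_sum_def by blast
qed

end
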